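(* Let $T$ be an unbounded non-negative self-adjoint operator in $\mathcal{H}$ and let $T_1,T_2$ be unbounded non-negative self-adjoint operators satisfying: $\operatorname{dom}T_k^{1/2}\cap\operatorname{dom}T=\{0\}$ ($k=1,2$); $\operatorname{dom}T_k^{1/2}\subset\operatorname{dom}T^{1/2}$ and $\|T_k^{1/2}g\|=\|T^{1/2}g\|$ for $g\in\operatorname{dom}T_k^{1/2}$ ($k=1,2$); $\operatorname{dom}T_1^{1/2}\cap\operatorname{dom}T_2^{1/2}=\{0\}$; and $\operatorname{dom}T^{1/2}=\operatorname{dom}T_1^{1/2}\dotplus\operatorname{dom}T_2^{1/2}$ with the summands orthogonal for $(f,g)_{T^{1/2}}=(T^{1/2}f,T^{1/2}g)+(f,g)$. Put $\mathcal{L}:=T^{1/2}$ and $\dot{\mathcal{L}}_k:=T^{1/2}\upharpoonright\operatorname{dom}T_k^{1/2}$, $k=1,2$. Then: (1) $\dot{\mathcal{L}}_1,\dot{\mathcal{L}}_2$ are closed densely defined symmetric operators; (2) $\operatorname{dom}\dot{\mathcal{L}}_1\cap\operatorname{dom}\mathcal{L}^2=\operatorname{dom}\dot{\mathcal{L}}_2\cap\operatorname{dom}\mathcal{L}^2=\{0\}$; (3) $\operatorname{dom}\dot{\mathcal{L}}_1\cap\operatorname{dom}\dot{\mathcal{L}}_2=\{0\}$ and $\operatorname{dom}\mathcal{L}=\operatorname{dom}\dot{\mathcal{L}}_1\dotplus\operatorname{dom}\dot{\mathcal{L}}_2$; (4) $\operatorname{dom}(\mathcal{L}\dot{\mathcal{L}}_1)=\operatorname{dom}(\mathcal{L}\dot{\mathcal{L}}_2)=\{0\}$;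 in particular $\operatorname{dom}\dot{\mathcal{L}}_1^2=\operatorname{dom}\dot{\mathcal{L}}_2^2=\{0\}$. If in addition $\operatorname{ran}T=\mathcal{H}$, then for $k=1,2$: (5) $\dot{\mathcal{L}}_k\mathcal{L}$ is densely defined (and non-negative symmetric); (6) $(\dot{\mathcal{L}}_k\mathcal{L})^*=\mathcal{L}\dot{\mathcal{L}}_k^*$; (7) $\operatorname{dom}(\dot{\mathcal{L}}_1\mathcal{L})\cap\operatorname{dom}(\dot{\mathcal{L}}_2\mathcal{L})=\{0\}$ and $\operatorname{dom}(\dot{\mathcal{L}}_1\mathcal{L})\dotplus\operatorname{dom}(\dot{\mathcal{L}}_2\mathcal{L})=\operatorname{dom}\mathcal{L}^2$; (8) $\mathcal{L}^2=T$ is the Friedrichs extension of $\dot{\mathcal{L}}_k\mathcal{L}$; (9) the Kreĭn extension of $\dot{\mathcal{L}}_k\mathcal{L}$ is $\dot{\mathcal{L}}_k\dot{\mathcal{L}}_k^*$.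
   Context: $\mathcal{H}$ is a complex, infinite-dimensional, separable Hilbert space. $S\upharpoonright\mathcal{N}$ is the restriction of $S$ to $\mathcal{N}$; products of unbounded operators have their natural domains, e.g. $\operatorname{dom}(ST)=\{f\in\operatorname{dom}T: Tf\in\operatorname{dom}S\}$. For a densely defined closed non-negative symmetric operator $\mathcal{A}$: the Friedrichs extension $\mathcal{A}_F$ is the non-negative self-adjoint operator associated with the closure of the form $(\mathcal{A}f,g)$, $f,g\in\operatorname{dom}\mathcal{A}$ (the maximal non-negative self-adjoint extension in the form sense); the Kreĭn extension $\mathcal{A}_K$ is the minimal non-negative self-adjoint extension, i.e. $\mathcal{A}_K\le\mathcal{C}\le\mathcal{A}_F$ for every non-negative self-adjoint extension $\mathcal{C}$ of $\mathcal{A}$ (in the sense $(\mathcal{A}_F+aI)^{-1}\le(\mathcal{C}+aI)^{-1}\le(\mathcal{A}_K+aI)^{-1}$ for $a>0$). $\dotplus$ denotes a direct sum. *)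

theory Defs
  imports Complex_Main "HOL-Library.Countable_Set"
begin

class cvector_space = ab_group_add +
  fixes cscale :: "complex \<Rightarrow> 'a \<Rightarrow> 'a"
  assumes cscale_add_right: "cscale a (x + y) = cscale a x + cscale a y"
    and cscale_add_left: "cscale (a + b) x = cscale a x + cscale b x"
    and cscale_cscale: "cscale a (cscale b x) = cscale (a * b) x"
    and cscale_one: "cscale 1 x = x"

class chilbert_space = cvector_space +
  fixes cinner :: "'a \<Rightarrow> 'a \<Rightarrow> complex"
  assumes cinner_cnj: "cinner x y = cnj (cinner y x)"
    and cinner_add_right: "cinner x (y + z) = cinner x y + cinner x z"
    and cinner_cscale_right: "cinner x (cscale a y) = a * cinner x y"
    and cinner_nonneg: "0 \<le> Re (cinner x x)"
    and cinner_eq_zero: "cinner x x = 0 \<Longrightarrow> x = 0"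
    and cinner_complete:
      "(\<forall>e>0. \<exists>N::nat. \<forall>m\<ge>N. \<forall>n\<ge>N. sqrt (Re (cinner (X m - X n) (X m - X n))) < e)
        \<Longrightarrow> \<exists>L. \<forall>e>0. \<exists>N::nat. \<forall>n\<ge>N. sqrt (Re (cinner (X n - L) (X n - L))) < e"

definition cnorm :: "'a::chilbert_space \<Rightarrow> real" where
  "cnorm x = sqrt (Re (cinner x x))"

definition ctends :: "(nat \<Rightarrow> 'a::chilbert_space) \<Rightarrow> 'a \<Rightarrow> bool" where
  "ctends X L \<longleftrightarrow> (\<forall>e>0. \<exists>N. \<forall>n\<ge>N. cnorm (X n - L) < e)"

definition cdense :: "'a::chilbert_space set \<Rightarrow> bool" where
  "cdense S \<longleftrightarrow> (\<forall>x e. e > 0 \<longrightarrow> (\<exists>y\<in>S. cnorm (x - y) < e))"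

definition separable_space :: "'a::chilbert_space itself \<Rightarrow> bool" where
  "separable_space _ \<longleftrightarrow> (\<exists>D::'a set. countable D \<and> cdense D)"

definition infinite_dimensional :: "'a::chilbert_space itself \<Rightarrow> bool" where
  "infinite_dimensional _ \<longleftrightarrow>
     (\<exists>e::nat \<Rightarrow> 'a. \<forall>i j. cinner (e i) (e j) = (if i = j then 1 else 0))"

definition is_linop :: "('a::chilbert_space \<times> 'a) set \<Rightarrow> bool" where
  "is_linop G \<longleftrightarrow> (0, 0) \<in> G
     \<and> (\<forall>x y u v. (x, y) \<in> G \<longrightarrow> (u, v) \<in> G \<longrightarrow> (x + u, y + v) \<in> G)
     \<and> (\<forall>a x y. (x, y) \<in> G \<longrightarrow> (cscale a x, cscale a y) \<in> G)
     \<and> (\<forall>y. (0, y) \<in> G \<longrightarrow> y = 0)"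

definition app :: "('a \<times> 'a) set \<Rightarrow> 'a \<Rightarrow> 'a" where
  "app G x = (THE y. (x, y) \<in> G)"

definition densely_defined :: "('a::chilbert_space \<times> 'a) set \<Rightarrow> bool" where
  "densely_defined G \<longleftrightarrow> cdense (Domain G)"

definition closed_op :: "('a::chilbert_space \<times> 'a) set \<Rightarrow> bool" where
  "closed_op G \<longleftrightarrow> (\<forall>X Y x y. (\<forall>n. (X n, Y n) \<in> G) \<longrightarrow> ctends X x \<longrightarrow> ctends Y y
      \<longrightarrow> (x, y) \<in> G)"

definition adj :: "('a::chilbert_space \<times> 'a) set \<Rightarrow> ('a \<times> 'a) set" where
  "adj G = {(y, z). \<forall>x w. (x, w) \<in> G \<longrightarrow> cinner w y = cinner x z}"

definition symmetric_op :: "('a::chilbert_space \<times> 'a) set \<Rightarrow> bool" where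
  "symmetric_op G \<longleftrightarrow> is_linop G \<and> densely_defined G \<and> G \<subseteq> adj G"

definition selfadjoint_op :: "('a::chilbert_space \<times> 'a) set \<Rightarrow> bool" where
  "selfadjoint_op G \<longleftrightarrow> is_linop G \<and> densely_defined G \<and> adj G = G"

definition nonneg_op :: "('a::chilbert_space \<times> 'a) set \<Rightarrow> bool" where
  "nonneg_op G \<longleftrightarrow> (\<forall>x y. (x, y) \<in> G \<longrightarrow> Im (cinner x y) = 0 \<and> 0 \<le> Re (cinner x y))"

definition unbounded_op :: "('a::chilbert_space \<times> 'a) set \<Rightarrow> bool" where
  "unbounded_op G \<longleftrightarrow> \<not> (\<exists>C. \<forall>x y. (x, y) \<in> G \<longrightarrow> cnorm y \<le> C * cnorm x)"

definition opcomp :: "('a \<times> 'a) set \<Rightarrow> ('a \<times> 'a) set \<Rightarrow> ('a \<times> 'a) set" where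
  "opcomp A B = {(x, z). \<exists>y. (x, y) \<in> B \<and> (y, z) \<in> A}"

definition op_restrict :: "('a \<times> 'a) set \<Rightarrow> 'a set \<Rightarrow> ('a \<times> 'a) set" where
  "op_restrict A N = {(x, y). (x, y) \<in> A \<and> x \<in> N}"

definition op_sqrt :: "('a::chilbert_space \<times> 'a) set \<Rightarrow> ('a \<times> 'a) set" where
  "op_sqrt T = (THE S. selfadjoint_op S \<and> nonneg_op S \<and> opcomp S S = T)"

definition direct_sum_eq :: "'a::chilbert_space set \<Rightarrow> 'a set \<Rightarrow> 'a set \<Rightarrow> bool" where
  "direct_sum_eq D D1 D2 \<longleftrightarrow> D1 \<inter> D2 = {0} \<and> D = {x + y |x y. x \<in> D1 \<and> y \<in> D2}"

text \<open>resolvent_le S C a : (S + aI)^{-1} \<le> (C + aI)^{-1} as bounded operators, i.e.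
  ((S+a)^{-1} h, h) \<le> ((C+a)^{-1} h, h) for every h.\<close>
definition resolvent_le :: "('a::chilbert_space \<times> 'a) set \<Rightarrow> ('a \<times> 'a) set \<Rightarrow> real \<Rightarrow> bool" where
  "resolvent_le S C a \<longleftrightarrow> (\<forall>x1 y1 x2 y2.
      (x1, y1) \<in> S \<longrightarrow> (x2, y2) \<in> C \<longrightarrow>
      y1 + cscale (complex_of_real a) x1 = y2 + cscale (complex_of_real a) x2 \<longrightarrow>
      Re (cinner (y1 + cscale (complex_of_real a) x1) x1)
        \<le> Re (cinner (y2 + cscale (complex_of_real a) x2) x2))"

definition nonneg_sa_ext :: "('a::chilbert_space \<times> 'a) set \<Rightarrow> ('a \<times> 'a) set \<Rightarrow> bool" where
  "nonneg_sa_ext A C \<longleftrightarrow> selfadjoint_op C \<and> nonneg_op C \<and> A \<subseteq> C"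

text \<open>Friedrichs extension: the maximal non-negative self-adjoint extension.\<close>
definition is_friedrichs_ext :: "('a::chilbert_space \<times> 'a) set \<Rightarrow> ('a \<times> 'a) set \<Rightarrow> bool" where
  "is_friedrichs_ext A S \<longleftrightarrow> nonneg_sa_ext A S
     \<and> (\<forall>C. nonneg_sa_ext A C \<longrightarrow> (\<forall>a>0. resolvent_le S C a))"

text \<open>Krein extension: the minimal non-negative self-adjoint extension.\<close>
definition is_krein_ext :: "('a::chilbert_space \<times> 'a) set \<Rightarrow> ('a \<times> 'a) set \<Rightarrow> bool" where
  "is_krein_ext A K \<longleftrightarrow> nonneg_sa_ext A K
     \<and> (\<forall>C. nonneg_sa_ext A C \<longrightarrow> (\<forall>a>0. resolvent_le C K a))"

end

theory Submission
  imports Defs "HOL-Library.Product_Plus"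
begin

text \<open>
  The unique non-negative root of \<open>T\<close> is \<open>C B\<^sup>-\<^sup>1\<close>, where \<open>B\<close> and \<open>C\<close> are the roots of the commuting
  contractions \<open>(T + I)\<^sup>-\<^sup>1\<close> and \<open>I - (T + I)\<^sup>-\<^sup>1\<close>. Since \<open>L\<close> and the root of \<open>T\<^sub>k\<close> have equal norms on
  the smaller domain, \<open>Ld\<^sub>k\<close> inherits closedness from the latter. If \<open>ran T\<close> is everything, \<open>L\<close> is
  bijective, and with \<open>V = L\<^sup>-\<^sup>1\<close> the domain of \<open>A = Ld L\<close> is \<open>V (dom Ld)\<close>. The pairs \<open>(V d, d)\<close> with
  \<open>d \<in> dom Ld\<close> are dense in the graph of \<open>L\<close>, so \<open>dom A\<close> is a core of the form of \<open>T\<close>, which makes \<open>T\<close>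
  maximal. Conversely every extension of \<open>A\<close> is contained in \<open>A\<^sup>* = L Ld\<^sup>*\<close>, and its form dominates
  \<open>\<parallel>Ld\<^sup>* v\<parallel>\<^sup>2\<close>, the form of \<open>Ld Ld\<^sup>*\<close>.
\<close>

section \<open>Inner products, limits and projection\<close>

lemma cscale_zero_left [simp]: "cscale 0 x = (0::'a::cvector_space)"
  using cscale_add_left[of 0 0 x] by simp

lemma cscale_zero_right [simp]: "cscale a 0 = (0::'a::cvector_space)"
  using cscale_add_right[of a 0 0] by simp

declare cscale_one [simp]

lemma cscale_minus_left [simp]: "cscale (- a) x = - cscale a (x::'a::cvector_space)"
  using cscale_add_left[of "- a" a x] by (simp add: eq_neg_iff_add_eq_0)

lemma cscale_minus_right [simp]: "cscale a (- x) = - cscale a (x::'a::cvector_space)"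
  using cscale_add_right[of a "- x" x] by (simp add: eq_neg_iff_add_eq_0)

lemma cscale_diff_right: "cscale a (x - y) = cscale a x - cscale a (y::'a::cvector_space)"
  using cscale_add_right[of a x "- y"] by simp

lemma cscale_half_add: "cscale (1/2) x + cscale (1/2) x = (x::'a::cvector_space)"
  using cscale_add_left[of "1/2" "1/2" x] by simp

lemma cinner_add_left: "cinner (x + y) z = cinner x z + cinner y (z::'a::chilbert_space)"
  by (subst (1 2 3) cinner_cnj) (simp add: cinner_add_right)

lemma cinner_cscale_left: "cinner (cscale a x) z = cnj a * cinner x (z::'a::chilbert_space)"
  by (subst (1 2) cinner_cnj) (simp add: cinner_cscale_right)

lemma cinner_zero_right [simp]: "cinner x (0::'a::chilbert_space) = 0"
  using cinner_cscale_right[of x 0 0] by simp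

lemma cinner_zero_left [simp]: "cinner (0::'a::chilbert_space) x = 0"
  using cinner_cscale_left[of 0 0 x] by simp

lemma cinner_minus_right [simp]: "cinner x (- y::'a::chilbert_space) = - cinner x y"
  using cinner_cscale_right[of x "-1" y] by simp

lemma cinner_minus_left [simp]: "cinner (- x) (y::'a::chilbert_space) = - cinner x y"
  using cinner_cscale_left[of "-1" x y] by simp

lemma cinner_diff_right: "cinner x (y - z::'a::chilbert_space) = cinner x y - cinner x z"
  using cinner_add_right[of x y "- z"] by simp

lemma cinner_diff_left: "cinner (x - y) (z::'a::chilbert_space) = cinner x z - cinner y z"
  using cinner_add_left[of x "- y" z] by simp

lemmas cinner_simps = cinner_add_left cinner_add_right cinner_diff_left cinner_diff_right
  cinner_cscale_left cinner_cscale_right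

lemma Re_cinner_commute: "Re (cinner x y) = Re (cinner y (x::'a::chilbert_space))"
  by (subst cinner_cnj) simp

lemma Im_cinner_commute: "Im (cinner x y) = - Im (cinner y (x::'a::chilbert_space))"
  by (subst cinner_cnj) simp

lemma Im_cinner_self [simp]: "Im (cinner x (x::'a::chilbert_space)) = 0"
  using Im_cinner_commute[of x x] by simp

lemma cnorm_ge_zero [simp]: "0 \<le> cnorm (x::'a::chilbert_space)"
  by (simp add: cnorm_def cinner_nonneg)

lemma cnorm_sq: "(cnorm x)\<^sup>2 = Re (cinner x (x::'a::chilbert_space))"
  by (simp add: cnorm_def cinner_nonneg)

lemma Re_cinner_self_eq_0: "Re (cinner x x) = 0 \<longleftrightarrow> x = (0::'a::chilbert_space)"
  by (metis Im_cinner_self cinner_eq_zero cinner_zero_right complex_eq_iff zero_complex.sel)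

lemma cnorm_eq_0 [simp]: "cnorm x = 0 \<longleftrightarrow> x = (0::'a::chilbert_space)"
  by (metis Re_cinner_self_eq_0 cnorm_sq zero_eq_power2)

lemma cnorm_zero [simp]: "cnorm (0::'a::chilbert_space) = 0"
  by simp

lemma cnorm_le_zero_iff [simp]: "cnorm x \<le> 0 \<longleftrightarrow> x = (0::'a::chilbert_space)"
  by (metis cnorm_eq_0 cnorm_ge_zero antisym order_refl)

lemma cnorm_minus [simp]: "cnorm (- x) = cnorm (x::'a::chilbert_space)"
  by (simp add: cnorm_def)

lemma cnorm_minus_commute: "cnorm (x - y) = cnorm (y - (x::'a::chilbert_space))"
  by (metis cnorm_minus minus_diff_eq)

lemma cnorm_cscale: "cnorm (cscale a x) = cmod a * cnorm (x::'a::chilbert_space)"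
proof -
  have "cinner (cscale a x) (cscale a x) = complex_of_real ((cmod a)\<^sup>2) * cinner x x"
    by (simp add: cinner_simps complex_norm_square mult_ac del: of_real_power)
  then have "(cnorm (cscale a x))\<^sup>2 = (cmod a * cnorm x)\<^sup>2"
    by (simp add: cnorm_sq power_mult_distrib del: of_real_power)
  then show ?thesis
    by (simp add: power2_eq_iff_nonneg)
qed

lemma cnorm_add_sq:
  "(cnorm (x + y))\<^sup>2 = (cnorm x)\<^sup>2 + 2 * Re (cinner x y) + (cnorm (y::'a::chilbert_space))\<^sup>2"
  using Re_cinner_commute[of x y] by (simp add: cnorm_sq cinner_simps)

lemma cnorm_diff_sq:
  "(cnorm (x - y))\<^sup>2 = (cnorm x)\<^sup>2 - 2 * Re (cinner x y) + (cnorm (y::'a::chilbert_space))\<^sup>2"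
  using Re_cinner_commute[of x y] by (simp add: cnorm_sq cinner_simps)

lemma Re_cinner_le: "Re (cinner x y) \<le> cnorm x * cnorm (y::'a::chilbert_space)"
proof (cases "x = 0 \<or> y = 0")
  case False
  define a where "a = cnorm x"
  define b where "b = cnorm y"
  have ab: "a > 0" "b > 0"
    using False by (simp_all add: a_def b_def less_le)
  \<comment> \<open>The weights \<open>b\<close> and \<open>a\<close> give both vectors the same
    norm, so the square is a multiple of the gap \<open>a * b - Re (cinner x y)\<close>.\<close>
  have "0 \<le> (cnorm (cscale (of_real b) x - cscale (of_real a) y))\<^sup>2"
    by simp
  also have "\<dots> = 2 * (a * b) * (a * b - Re (cinner x y))"
    by (simp add: cnorm_diff_sq cnorm_cscale cinner_simps flip: a_def b_def)
       (simp add: algebra_simps power2_eq_square)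
  finally have "0 \<le> a * b - Re (cinner x y)"
    using ab by (smt (verit) mult_pos_pos zero_le_mult_iff)
  then show ?thesis by (simp add: a_def b_def)
qed auto

text \<open>Multiplying \<open>y\<close> by \<open>cnj (cinner x y)\<close> turns the inner product
  into its squared modulus, which reduces the claim to the bound on real parts.\<close>

lemma cmod_cinner_le: "cmod (cinner x y) \<le> cnorm x * cnorm (y::'a::chilbert_space)"
proof (cases "cinner x y = 0")
  case False
  define c where "c = cinner x y"
  have "(cmod c)\<^sup>2 = Re (cinner x (cscale (cnj c) y))"
    using cmod_power2[of c] by (simp add: cinner_simps power2_eq_square flip: c_def)
  also have "\<dots> \<le> cmod c * (cnorm x * cnorm y)"
    using Re_cinner_le[of x "cscale (cnj c) y"] by (simp add: cnorm_cscale mult_ac)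
  finally show ?thesis
    using False by (simp add: c_def power2_eq_square)
qed simp

lemma cnorm_triangle: "cnorm (x + y) \<le> cnorm x + cnorm (y::'a::chilbert_space)"
proof (rule power2_le_imp_le)
  show "(cnorm (x + y))\<^sup>2 \<le> (cnorm x + cnorm y)\<^sup>2"
    using Re_cinner_le[of x y] by (simp add: cnorm_add_sq power2_sum)
qed simp

lemma cnorm_triangle_mid: "cnorm (x - z) \<le> cnorm (x - y) + cnorm (y - z::'a::chilbert_space)"
  using cnorm_triangle[of "x - y" "y - z"] by simp

lemma cinner_ext: "(\<And>z. cinner z x = cinner z y) \<Longrightarrow> x = (y::'a::chilbert_space)"
  by (metis cinner_diff_right cinner_eq_zero diff_self eq_iff_diff_eq_0)

section \<open>Limits of sequences and completeness\<close>

lemma ctends_iff: "ctends X L \<longleftrightarrow> (\<lambda>n. cnorm (X n - L)) \<longlonglongrightarrow> 0"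
  by (auto simp: ctends_def LIMSEQ_def)

lemma ctends_const: "ctends (\<lambda>n. c) (c::'a::chilbert_space)"
  by (simp add: ctends_iff)

lemma ctendsI:
  fixes L :: "'a::chilbert_space"
  assumes "r \<longlonglongrightarrow> 0" "\<And>n. cnorm (X n - L) \<le> r n"
  shows "ctends X L"
  unfolding ctends_iff by (rule tendsto_sandwich[OF _ _ tendsto_const assms(1)]) (simp_all add: assms(2))

lemma ctends_add:
  fixes a b :: "'a::chilbert_space"
  assumes "ctends X a" "ctends Y b"
  shows "ctends (\<lambda>n. X n + Y n) (a + b)"
proof (rule ctendsI)
  show "(\<lambda>n. cnorm (X n - a) + cnorm (Y n - b)) \<longlonglongrightarrow> 0"
    using tendsto_add[OF assms[unfolded ctends_iff]] by simp
  show "cnorm (X n + Y n - (a + b)) \<le> cnorm (X n - a) + cnorm (Y n - b)" for n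
    using cnorm_triangle[of "X n - a" "Y n - b"] by (simp add: algebra_simps)
qed

lemma ctends_cscale:
  fixes a :: "'a::chilbert_space"
  assumes "ctends X a"
  shows "ctends (\<lambda>n. cscale c (X n)) (cscale c a)"
  using tendsto_mult_left[OF assms[unfolded ctends_iff], of "cmod c"]
  by (simp add: ctends_iff cnorm_cscale flip: cscale_diff_right)

lemma ctends_diff:
  fixes a b :: "'a::chilbert_space"
  assumes "ctends X a" "ctends Y b"
  shows "ctends (\<lambda>n. X n - Y n) (a - b)"
  using ctends_add[OF assms(1) ctends_cscale[OF assms(2), of "-1"]] by simp

lemma ctends_Suc: "ctends X a \<Longrightarrow> ctends (\<lambda>n. X (Suc n)) (a::'a::chilbert_space)"
  unfolding ctends_iff by (rule LIMSEQ_Suc)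

lemma tendsto_if_norm_diff_le:
  fixes f :: "nat \<Rightarrow> 'b::real_normed_vector"
  assumes "g \<longlonglongrightarrow> 0" "\<And>n. norm (f n - l) \<le> g n"
  shows "f \<longlonglongrightarrow> l"
  by (rule LIM_zero_cancel, rule tendsto_norm_zero_cancel,
      rule tendsto_sandwich[OF _ _ tendsto_const assms(1)]) (simp_all add: assms(2))

lemma ctends_cinner_right:
  fixes a b :: "'a::chilbert_space"
  assumes "ctends X a"
  shows "(\<lambda>n. cinner b (X n)) \<longlonglongrightarrow> cinner b a"
proof (rule tendsto_if_norm_diff_le)
  show "(\<lambda>n. cnorm b * cnorm (X n - a)) \<longlonglongrightarrow> 0"
    using tendsto_mult_left[OF assms[unfolded ctends_iff], of "cnorm b"] by simp
  show "norm (cinner b (X n) - cinner b a) \<le> cnorm b * cnorm (X n - a)" for n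
    by (simp add: cmod_cinner_le flip: cinner_diff_right)
qed

lemma ctends_cinner_left:
  fixes a b :: "'a::chilbert_space"
  assumes "ctends X a"
  shows "(\<lambda>n. cinner (X n) b) \<longlonglongrightarrow> cinner a b"
  by (subst (1 2) cinner_cnj) (intro tendsto_cnj ctends_cinner_right assms)

lemma ctends_unique:
  fixes a b :: "'a::chilbert_space"
  assumes "ctends X a" "ctends X b"
  shows "a = b"
  by (rule cinner_ext) (rule LIMSEQ_unique[OF ctends_cinner_right[OF assms(1)] ctends_cinner_right[OF assms(2)]])

lemma ctends_cnorm:
  fixes a :: "'a::chilbert_space"
  assumes "ctends X a"
  shows "(\<lambda>n. cnorm (X n)) \<longlonglongrightarrow> cnorm a"
proof (rule tendsto_if_norm_diff_le[OF assms[unfolded ctends_iff]])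
  show "norm (cnorm (X n) - cnorm a) \<le> cnorm (X n - a)" for n
    using cnorm_triangle[of "X n - a" a] cnorm_triangle[of "a - X n" "X n"]
      cnorm_minus_commute[of a "X n"] by simp
qed

lemma cCauchy_convergent:
  fixes X :: "nat \<Rightarrow> 'a::chilbert_space"
  assumes "\<And>e. e > 0 \<Longrightarrow> \<exists>N. \<forall>m\<ge>N. \<forall>n\<ge>N. cnorm (X m - X n) < e"
  shows "\<exists>L. ctends X L"
  using cinner_complete[of X] assms by (simp add: ctends_def cnorm_def)

lemma ctends_cCauchy:
  fixes X :: "nat \<Rightarrow> 'a::chilbert_space"
  assumes "ctends X L" "e > 0"
  shows "\<exists>N. \<forall>m\<ge>N. \<forall>n\<ge>N. cnorm (X m - X n) < e"
proof -
  obtain N where N: "\<And>n. n \<ge> N \<Longrightarrow> cnorm (X n - L) < e / 2"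
    using assms by (meson ctends_def half_gt_zero)
  have "cnorm (X m - X n) < e" if "m \<ge> N" "n \<ge> N" for m n
    using N[OF that(1)] N[OF that(2)] cnorm_triangle_mid[of "X m" "X n" L] cnorm_minus_commute[of L "X n"]
    by simp
  then show ?thesis by blast
qed

text \<open>Completeness transfers convergence from \<open>X\<close> to \<open>Y\<close>; this
  serves whenever the increments of one sequence are controlled by those of another.\<close>

lemma ctends_dominated:
  fixes X :: "nat \<Rightarrow> 'a::chilbert_space" and Y :: "nat \<Rightarrow> 'b::chilbert_space"
  assumes "ctends X L" "\<And>m n. cnorm (Y m - Y n) \<le> cnorm (X m - X n)"
  shows "\<exists>M. ctends Y M"
  by (rule cCauchy_convergent) (meson assms ctends_cCauchy le_less_trans)

section \<open>Subspaces, orthogonal projection and density\<close>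

definition csubspace :: "'a::chilbert_space set \<Rightarrow> bool" where
  "csubspace M \<longleftrightarrow> 0 \<in> M \<and> (\<forall>x\<in>M. \<forall>y\<in>M. x + y \<in> M) \<and> (\<forall>a. \<forall>x\<in>M. cscale a x \<in> M)"

text \<open>The midpoint form of the parallelogram law, which forces a minimising sequence to be
  Cauchy.\<close>

lemma parallelogram:
  "(cnorm (x - y))\<^sup>2 + 4 * (cnorm (z - cscale (1/2) (x + y)))\<^sup>2
     = 2 * (cnorm (z - x))\<^sup>2 + 2 * (cnorm (z - (y::'a::chilbert_space)))\<^sup>2"
proof -
  have "4 * (cnorm (z - cscale (1/2) (x + y)))\<^sup>2 = (cnorm ((z - x) + (z - y)))\<^sup>2"
  proof -
    have "cscale (1/2) ((z - x) + (z - y)) = cscale (1/2) (z + z) - cscale (1/2) (x + y)"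
      by (simp add: algebra_simps cscale_add_right cscale_diff_right)
    also have "cscale (1/2) (z + z) = z"
      by (simp add: cscale_add_right cscale_half_add)
    finally have "cnorm (z - cscale (1/2) (x + y)) = (1/2) * cnorm ((z - x) + (z - y))"
      by (metis (no_types) cnorm_cscale norm_divide norm_numeral norm_one)
    then have "cnorm ((z - x) + (z - y)) = 2 * cnorm (z - cscale (1/2) (x + y))" by simp
    then show ?thesis by (simp only: power_mult_distrib) simp
  qed
  moreover have "cnorm (x - y) = cnorm ((z - x) - (z - y))"
    by (simp add: cnorm_minus_commute)
  ultimately show ?thesis
    by (simp only: cnorm_add_sq cnorm_diff_sq[of "z - x" "z - y"])
qed

text \<open>Since \<open>M\<close> is an arbitrary subspace, the best approximation \<open>m\<close>
  lies in its closure and is returned together with a sequence from \<open>M\<close>.\<close>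

lemma projection:
  fixes M :: "'a::chilbert_space set"
  assumes M: "csubspace M"
  shows "\<exists>X m. (\<forall>n. X n \<in> M) \<and> ctends X m \<and> (\<forall>g\<in>M. cinner g (x - m) = 0)"
proof -
  define d where "d = (INF m\<in>M. (cnorm (x - m))\<^sup>2)"
  have d_le: "d \<le> (cnorm (x - m))\<^sup>2" if "m \<in> M" for m
    unfolding d_def by (rule cINF_lower[OF _ that]) (auto intro: bdd_belowI[of _ 0])
  have "\<exists>m\<in>M. (cnorm (x - m))\<^sup>2 < d + inverse (real (Suc n))" for n
  proof (rule ccontr)
    assume "\<not> ?thesis"
    then have "d + inverse (real (Suc n)) \<le> d"
      unfolding d_def using M by (intro cINF_greatest) (auto simp: csubspace_def not_less)
    then show False by simp
  qed
  then obtain X where X: "\<And>n. X n \<in> M" "\<And>n. (cnorm (x - X n))\<^sup>2 < d + inverse (real (Suc n))"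
    by metis
  have cauchy: "(cnorm (X i - X j))\<^sup>2 \<le> 2 * inverse (real (Suc i)) + 2 * inverse (real (Suc j))" for i j
  proof -
    \<comment> \<open>The midpoint stays in \<open>M\<close>, so its squared distance to
      \<open>x\<close> is at least \<open>d\<close>.\<close>
    have "cscale (1/2) (X i + X j) \<in> M"
      using M X(1) by (simp add: csubspace_def)
    from d_le[OF this] show ?thesis
      using parallelogram[of "X i" "X j" x] X(2)[of i] X(2)[of j] by linarith
  qed
  obtain m where m: "ctends X m"
  proof -
    have "\<exists>N. \<forall>i\<ge>N. \<forall>j\<ge>N. cnorm (X i - X j) < e" if "e > 0" for e
    proof -
      obtain N where N: "inverse (real (Suc N)) < e\<^sup>2 / 4"
        using reals_Archimedean[of "e\<^sup>2 / 4"] \<open>e > 0\<close> zero_less_power[of e 2]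
        by (metis zero_less_divide_iff zero_less_numeral)
      have "cnorm (X i - X j) < e" if ij: "i \<ge> N" "j \<ge> N" for i j
      proof (rule power2_less_imp_less)
        have "inverse (real (Suc i)) \<le> inverse (real (Suc N))"
             "inverse (real (Suc j)) \<le> inverse (real (Suc N))"
          using ij by (auto intro!: le_imp_inverse_le)
        then show "(cnorm (X i - X j))\<^sup>2 < e\<^sup>2"
          using cauchy[of i j] N by linarith
      qed (use \<open>e > 0\<close> in simp)
      then show ?thesis by blast
    qed
    then show ?thesis using cCauchy_convergent that by blast
  qed
  have dm: "(cnorm (x - m))\<^sup>2 \<le> d"
  proof (rule LIMSEQ_le)
    show "(\<lambda>n. (cnorm (x - X n))\<^sup>2) \<longlonglongrightarrow> (cnorm (x - m))\<^sup>2"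
      by (intro tendsto_power ctends_cnorm ctends_diff ctends_const m)
    show "(\<lambda>n. d + inverse (real (Suc n))) \<longlonglongrightarrow> d"
      using tendsto_add[OF tendsto_const LIMSEQ_inverse_real_of_nat, of d] by simp
    show "\<exists>N. \<forall>n\<ge>N. (cnorm (x - X n))\<^sup>2 \<le> d + inverse (real (Suc n))"
      using X(2) less_imp_le by blast
  qed
  have md: "d \<le> (cnorm (x - m - g))\<^sup>2" if "g \<in> M" for g
  proof (rule LIMSEQ_le_const)
    show "(\<lambda>n. (cnorm (x - X n - g))\<^sup>2) \<longlonglongrightarrow> (cnorm (x - m - g))\<^sup>2"
      by (intro tendsto_power ctends_cnorm ctends_diff ctends_const m)
    have "d \<le> (cnorm (x - X n - g))\<^sup>2" for n
      using d_le[of "X n + g"] X(1) that M by (simp add: csubspace_def diff_diff_eq)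
    then show "\<exists>N. \<forall>n\<ge>N. d \<le> (cnorm (x - X n - g))\<^sup>2" by blast
  qed
  have "cinner g (x - m) = 0" if g: "g \<in> M" for g
  proof -
    define p where "p = x - m"
    define c where "c = cinner g p"
    \<comment> \<open>The step length satisfies \<open>s * (cnorm g)\<^sup>2 < 1\<close>, so moving
      from \<open>m\<close> by \<open>k = s c g\<close> would bring it closer to \<open>x\<close>
      unless \<open>c = 0\<close>.\<close>
    define s where "s = 1 / (1 + (cnorm g)\<^sup>2)"
    have s: "s > 0" "s * (cnorm g)\<^sup>2 < 1"
      by (auto simp: s_def field_simps add_pos_nonneg)
    define k where "k = cscale (of_real s * c) g"
    have "k \<in> M" using g M by (simp add: csubspace_def k_def)
    then have "(cnorm p)\<^sup>2 \<le> (cnorm (p - k))\<^sup>2"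
      using order_trans[OF dm md] by (simp add: p_def)
    then have "2 * Re (cinner p k) \<le> (cnorm k)\<^sup>2"
      by (simp add: cnorm_diff_sq)
    moreover have "cinner p k = of_real s * of_real ((cmod c)\<^sup>2)"
      using cinner_cnj[of p g] by (simp add: k_def cinner_simps c_def complex_norm_square
        mult_ac del: of_real_power)
    moreover have "cnorm k = s * cmod c * cnorm g"
      using s by (simp add: k_def cnorm_cscale norm_mult)
    ultimately have "2 * s * (cmod c)\<^sup>2 \<le> s * (cmod c)\<^sup>2 * (s * (cnorm g)\<^sup>2)"
      by (simp add: power_mult_distrib power2_eq_square mult_ac)
    also have "\<dots> \<le> s * (cmod c)\<^sup>2 * 1"
      using s by (intro mult_left_mono) auto
    finally have "s * (cmod c)\<^sup>2 \<le> 0" by simp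
    then show ?thesis using s by (simp add: mult_le_0_iff c_def p_def)
  qed
  with X(1) m show ?thesis by blast
qed

text \<open>The residual \<open>x - m\<close> is orthogonal to \<open>M\<close>, hence to the limit
  \<open>m\<close> and, by \<open>orth\<close>, to \<open>x\<close>; so it is orthogonal to
  itself.\<close>

lemma closure_if_orthogonal:
  fixes M :: "'a::chilbert_space set"
  assumes "csubspace M" and orth: "\<And>p. (\<And>g. g \<in> M \<Longrightarrow> cinner g p = 0) \<Longrightarrow> cinner p x = 0"
  shows "\<exists>X. (\<forall>n. X n \<in> M) \<and> ctends X x"
proof -
  obtain X m where X: "\<And>n. X n \<in> M" "ctends X m" and p: "\<And>g. g \<in> M \<Longrightarrow> cinner g (x - m) = 0"
    using projection[OF assms(1)] by metis
  have "(\<lambda>n. cinner (X n) (x - m)) \<longlonglongrightarrow> cinner m (x - m)"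
    by (rule ctends_cinner_left[OF X(2)])
  then have "cinner m (x - m) = 0"
    using p[OF X(1)] by (simp add: LIMSEQ_const_iff)
  moreover have "cinner x (x - m) = 0"
    using orth[OF p] cinner_cnj[of x "x - m"] by simp
  ultimately have "x - m = 0"
    by (intro cinner_eq_zero) (simp add: cinner_diff_left)
  then show ?thesis using X by auto
qed

lemma cdense_if_orthogonal:
  fixes M :: "'a::chilbert_space set"
  assumes "csubspace M" and "\<And>p. (\<And>g. g \<in> M \<Longrightarrow> cinner g p = 0) \<Longrightarrow> p = 0"
  shows "cdense M"
  unfolding cdense_def
proof (intro allI impI)
  fix x :: 'a and e :: real assume e: "e > 0"
  obtain X where X: "\<And>n. X n \<in> M" "ctends X x"
    using closure_if_orthogonal[OF assms(1), of x] assms(2) by (metis cinner_zero_left)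
  then obtain n where "cnorm (X n - x) < e"
    using e by (meson ctends_def order_refl)
  then show "\<exists>y\<in>M. cnorm (x - y) < e"
    using X(1) by (metis cnorm_minus_commute)
qed

lemma cdense_sequence:
  assumes "cdense D"
  shows "\<exists>X. (\<forall>n. X n \<in> D) \<and> ctends X (x::'a::chilbert_space)"
proof -
  have "\<exists>y\<in>D. cnorm (x - y) < inverse (real (Suc n))" for n
    using assms by (simp add: cdense_def)
  then obtain X where X: "\<And>n. X n \<in> D" "\<And>n. cnorm (x - X n) < inverse (real (Suc n))"
    by metis
  have "ctends X x"
    by (rule ctendsI[OF LIMSEQ_inverse_real_of_nat]) (metis X(2) cnorm_minus_commute less_imp_le)
  then show ?thesis using X(1) by blast
qed

lemma cdense_orthogonal:
  assumes "cdense D" "\<And>d. d \<in> D \<Longrightarrow> cinner d p = 0"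
  shows "p = (0::'a::chilbert_space)"
proof -
  obtain X where X: "\<And>n. X n \<in> D" "ctends X p"
    using cdense_sequence[OF assms(1)] by blast
  show ?thesis
    using ctends_cinner_left[OF X(2), of p] assms(2)[OF X(1)]
    by (auto simp: LIMSEQ_const_iff intro: cinner_eq_zero)
qed

text \<open>Graphs of operators become subspaces of this Hilbert space, so that projection and
  closure arguments apply to them.\<close>

instantiation prod :: (chilbert_space, chilbert_space) chilbert_space
begin

definition cscale_prod :: "complex \<Rightarrow> 'a \<times> 'b \<Rightarrow> 'a \<times> 'b" where
  "cscale_prod c p = (cscale c (fst p), cscale c (snd p))"

definition cinner_prod :: "'a \<times> 'b \<Rightarrow> 'a \<times> 'b \<Rightarrow> complex" where
  "cinner_prod p q = cinner (fst p) (fst q) + cinner (snd p) (snd q)"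

instance
proof
  fix X :: "nat \<Rightarrow> 'a \<times> 'b"
  have comp: "Re (cinner (fst p) (fst p)) \<le> Re (cinner p p)"
       "Re (cinner (snd p) (snd p)) \<le> Re (cinner p p)" for p :: "'a \<times> 'b"
    by (simp_all add: cinner_prod_def cinner_nonneg)
  assume *: "\<forall>e>0. \<exists>N. \<forall>m\<ge>N. \<forall>n\<ge>N. sqrt (Re (cinner (X m - X n) (X m - X n))) < e"
  have "\<exists>N. \<forall>m\<ge>N. \<forall>n\<ge>N. cnorm (fst (X m) - fst (X n)) < e" if "e > 0" for e
    using * that comp(1) unfolding cnorm_def fst_diff[symmetric]
    by (meson le_less_trans real_sqrt_le_mono)
  then obtain a where a: "ctends (\<lambda>n. fst (X n)) a"
    using cCauchy_convergent[of "\<lambda>n. fst (X n)"] by blast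
  have "\<exists>N. \<forall>m\<ge>N. \<forall>n\<ge>N. cnorm (snd (X m) - snd (X n)) < e" if "e > 0" for e
    using * that comp(2) unfolding cnorm_def snd_diff[symmetric]
    by (meson le_less_trans real_sqrt_le_mono)
  then obtain b where b: "ctends (\<lambda>n. snd (X n)) b"
    using cCauchy_convergent[of "\<lambda>n. snd (X n)"] by blast
  have "(\<lambda>n. sqrt ((cnorm (fst (X n) - a))\<^sup>2 + (cnorm (snd (X n) - b))\<^sup>2)) \<longlonglongrightarrow> 0"
    using a b unfolding ctends_iff by (auto intro!: tendsto_eq_intros)
  then have "(\<lambda>n. sqrt (Re (cinner (X n - (a, b)) (X n - (a, b))))) \<longlonglongrightarrow> 0"
    by (simp add: cinner_prod_def cnorm_sq)
  moreover have "norm (sqrt (Re (cinner p p))) = sqrt (Re (cinner p p))" for p :: "'a \<times> 'b"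
    by (simp add: cinner_prod_def cinner_nonneg)
  ultimately show "\<exists>L. \<forall>e>0. \<exists>N. \<forall>n\<ge>N. sqrt (Re (cinner (X n - L) (X n - L))) < e"
    by (intro exI[of _ "(a, b)"]) (simp add: LIMSEQ_def)
next
  fix x y :: "'a \<times> 'b"
  show "cinner x y = cnj (cinner y x)"
    unfolding cinner_prod_def complex_cnj_add by (metis cinner_cnj)
  show "0 \<le> Re (cinner x x)"
    by (simp add: cinner_prod_def cinner_nonneg)
  assume "cinner x x = 0"
  then have "Re (cinner (fst x) (fst x)) + Re (cinner (snd x) (snd x)) = 0"
    unfolding cinner_prod_def by (metis plus_complex.sel(1) zero_complex.sel(1))
  then show "x = 0"
    using cinner_nonneg[of "fst x"] cinner_nonneg[of "snd x"]
    by (simp add: add_nonneg_eq_0_iff Re_cinner_self_eq_0 prod_eq_iff)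
qed (auto simp: cscale_prod_def cinner_prod_def cscale_add_left cscale_add_right cscale_cscale
      cinner_simps algebra_simps prod_eq_iff)

end

lemma cnorm_Pair_sq: "(cnorm (x, y))\<^sup>2 = (cnorm x)\<^sup>2 + (cnorm (y::'a::chilbert_space))\<^sup>2"
  by (simp add: cnorm_sq cinner_prod_def)

lemma ctends_PairD:
  fixes x y :: "'a::chilbert_space"
  assumes "ctends X (x, y)"
  shows "ctends (\<lambda>n. fst (X n)) x" "ctends (\<lambda>n. snd (X n)) y"
proof -
  have *: "cnorm (fst p) \<le> cnorm p" "cnorm (snd p) \<le> cnorm p" for p :: "'a \<times> 'a"
    using cnorm_Pair_sq[of "fst p" "snd p"]
    by (auto intro: power2_le_imp_le[OF _ cnorm_ge_zero])
  show "ctends (\<lambda>n. fst (X n)) x" "ctends (\<lambda>n. snd (X n)) y"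
    by (rule ctendsI[OF assms[unfolded ctends_iff]], use *[of "X _ - (x, y)"] in simp)+
qed

section \<open>Square roots of bounded operators\<close>

text \<open>Linearity follows from the symmetry of an everywhere defined map.\<close>

definition sym_contraction :: "('a::chilbert_space \<Rightarrow> 'a) \<Rightarrow> bool" where
  "sym_contraction A \<longleftrightarrow>
     (\<forall>x y. cinner (A x) y = cinner x (A y)) \<and> (\<forall>x. cnorm (A x) \<le> cnorm x)"

lemma sym_contractionD:
  assumes "sym_contraction A"
  shows "cinner (A x) y = cinner x (A y)" "cnorm (A x) \<le> cnorm x"
  using assms by (simp_all add: sym_contraction_def)

lemma sym_contraction_add:
  assumes "sym_contraction A"
  shows "A (x + y) = A x + A y"
  by (rule cinner_ext) (simp add: cinner_simps flip: sym_contractionD(1)[OF assms])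

lemma sym_contraction_cscale:
  assumes "sym_contraction A"
  shows "A (cscale c x) = cscale c (A x)"
  by (rule cinner_ext) (simp add: cinner_simps flip: sym_contractionD(1)[OF assms])

lemma sym_contraction_diff:
  assumes "sym_contraction A"
  shows "A (x - y) = A x - A y"
  by (rule cinner_ext) (simp add: cinner_simps flip: sym_contractionD(1)[OF assms])

lemma sym_contraction_zero: "sym_contraction A \<Longrightarrow> A 0 = 0"
  using sym_contractionD(2)[of A 0] by simp

lemma ctends_sym_contraction:
  assumes "sym_contraction A" "ctends X x"
  shows "ctends (\<lambda>n. A (X n)) (A x)"
  by (rule ctendsI[OF assms(2)[unfolded ctends_iff]])
     (simp add: sym_contractionD(2)[OF assms(1)] flip: sym_contraction_diff[OF assms(1)])

text \<open>A fixed point \<open>Y\<close> of this recursion satisfies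
  \<open>(I - Y)^2 = I - Z\<close>.\<close>

primrec sqrt_iter :: "('a::chilbert_space \<Rightarrow> 'a) \<Rightarrow> nat \<Rightarrow> 'a \<Rightarrow> 'a" where
  "sqrt_iter Z 0 x = 0"
| "sqrt_iter Z (Suc n) x = cscale (1/2) (Z x + sqrt_iter Z n (sqrt_iter Z n x))"

text \<open>The scalar iteration with \<open>Z = 1\<close> majorises both the norms and the increments of the
  operator iteration, whence the latter converges.\<close>

primrec sqrt_bound :: "nat \<Rightarrow> real" where
  "sqrt_bound 0 = 0"
| "sqrt_bound (Suc n) = (1 + (sqrt_bound n)\<^sup>2) / 2"

lemma sqrt_bound_range: "0 \<le> sqrt_bound n \<and> sqrt_bound n \<le> 1"
proof (induction n)
  case (Suc n)
  then have "(sqrt_bound n)\<^sup>2 \<le> 1" by (simp add: power_le_one)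
  then show ?case by simp
qed simp

text \<open>The increment is \<open>(sqrt_bound n - 1)^2 / 2\<close>.\<close>

lemma sqrt_bound_incseq: "incseq sqrt_bound"
proof (rule incseq_SucI)
  show "sqrt_bound n \<le> sqrt_bound (Suc n)" for n
    using zero_le_power2[of "sqrt_bound n - 1"] by (simp add: power2_diff)
qed

lemma sqrt_iter_sym_contraction:
  assumes Z: "sym_contraction Z"
  shows "sym_contraction (sqrt_iter Z n)"
proof (induction n)
  case (Suc n)
  have "cnorm (sqrt_iter Z (Suc n) x) \<le> cnorm x" for x
  proof -
    have "cnorm (sqrt_iter Z n (sqrt_iter Z n x)) \<le> cnorm x"
      using sym_contractionD(2)[OF Suc] order_trans by blast
    then show ?thesis
      using cnorm_triangle[of "Z x" "sqrt_iter Z n (sqrt_iter Z n x)"] sym_contractionD(2)[OF Z, of x]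
      by (simp add: cnorm_cscale norm_divide)
  qed
  moreover have "cinner (sqrt_iter Z (Suc n) x) y = cinner x (sqrt_iter Z (Suc n) y)" for x y
    by (simp add: cinner_simps sym_contractionD(1)[OF Z] sym_contractionD(1)[OF Suc])
  ultimately show ?case unfolding sym_contraction_def by blast
qed (simp add: sym_contraction_def)

lemma sqrt_iter_commute:
  assumes K: "sym_contraction K" "\<And>x. K (Z x) = Z (K x)"
  shows "K (sqrt_iter Z n x) = sqrt_iter Z n (K x)"
proof (induction n arbitrary: x)
  case (Suc n)
  then show ?case
    by (simp add: sym_contraction_cscale[OF K(1)] sym_contraction_add[OF K(1)] K(2))
qed (simp add: sym_contraction_zero[OF K(1)])

text \<open>Each iterate commutes with \<open>Z\<close>, and therefore with everything the recursion
  builds from \<open>Z\<close>.\<close>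

lemma sqrt_iter_commute_iter:
  assumes Z: "sym_contraction Z"
  shows "sqrt_iter Z m (sqrt_iter Z n x) = sqrt_iter Z n (sqrt_iter Z m x)"
  by (intro sqrt_iter_commute sqrt_iter_sym_contraction Z) (simp add: sqrt_iter_commute[OF Z])

lemma sqrt_iter_bound:
  assumes Z: "sym_contraction Z"
  shows "cnorm (sqrt_iter Z n x) \<le> sqrt_bound n * cnorm x"
proof (induction n arbitrary: x)
  case (Suc n)
  have "cnorm (sqrt_iter Z n (sqrt_iter Z n x)) \<le> sqrt_bound n * cnorm (sqrt_iter Z n x)"
    by (rule Suc)
  also have "\<dots> \<le> sqrt_bound n * (sqrt_bound n * cnorm x)"
    using Suc sqrt_bound_range by (intro mult_left_mono) auto
  finally show ?case
    using cnorm_triangle[of "Z x" "sqrt_iter Z n (sqrt_iter Z n x)"] sym_contractionD(2)[OF Z, of x]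
    by (simp add: cnorm_cscale norm_divide power2_eq_square algebra_simps)
qed simp

text \<open>Consecutive iterates commute, so the difference of their squares factors as
  \<open>(Y' + Y) (Y' - Y)\<close>. The scalar recursion factors in the same way, which closes the
  induction.\<close>

lemma sqrt_iter_step:
  assumes Z: "sym_contraction Z"
  shows "cnorm (sqrt_iter Z (Suc n) x - sqrt_iter Z n x)
          \<le> (sqrt_bound (Suc n) - sqrt_bound n) * cnorm x"
proof (induction n)
  case 0
  show ?case using sym_contractionD(2)[OF Z, of x] by (simp add: cnorm_cscale norm_divide)
next
  case (Suc n)
  let ?Y = "sqrt_iter Z n" and ?Y' = "sqrt_iter Z (Suc n)"
  let ?r = "sqrt_bound n" and ?r' = "sqrt_bound (Suc n)"
  define w where "w = ?Y' x - ?Y x"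
  have "?Y' w + ?Y w = ?Y' (?Y' x) - ?Y (?Y x)"
    unfolding w_def sym_contraction_diff[OF sqrt_iter_sym_contraction[OF Z]]
    using sqrt_iter_commute_iter[OF Z, of "Suc n" n x] by simp
  then have "sqrt_iter Z (Suc (Suc n)) x - ?Y' x = cscale (1/2) (?Y' w + ?Y w)"
    by (simp only: sqrt_iter.simps(2)[of Z "Suc n" x] sqrt_iter.simps(2)[of Z n x]
        flip: cscale_diff_right) simp
  then have "cnorm (sqrt_iter Z (Suc (Suc n)) x - ?Y' x) = cnorm (?Y' w + ?Y w) / 2"
    by (simp add: cnorm_cscale norm_divide)
  also have "\<dots> \<le> (?r' * cnorm w + ?r * cnorm w) / 2"
    by (intro divide_right_mono order_trans[OF cnorm_triangle] add_mono sqrt_iter_bound Z) simp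
  also have "\<dots> = ((?r' + ?r) / 2) * cnorm w" by (simp add: algebra_simps add_divide_distrib)
  also have "\<dots> \<le> ((?r' + ?r) / 2) * ((?r' - ?r) * cnorm x)"
    using Suc sqrt_bound_range[of n] sqrt_bound_range[of "Suc n"]
    unfolding w_def by (intro mult_left_mono) auto
  also have "\<dots> = (sqrt_bound (Suc (Suc n)) - ?r') * cnorm x"
    by (simp only: sqrt_bound.simps(2)[of "Suc n"] sqrt_bound.simps(2)[of n])
       (simp add: algebra_simps power2_eq_square add_divide_distrib diff_divide_distrib)
  finally show ?case .
qed

lemma sqrt_iter_diff:
  assumes Z: "sym_contraction Z" and "m \<le> n"
  shows "cnorm (sqrt_iter Z n x - sqrt_iter Z m x) \<le> (sqrt_bound n - sqrt_bound m) * cnorm x"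
  using \<open>m \<le> n\<close>
proof (induction n rule: dec_induct)
  case (step n)
  then show ?case
    using cnorm_triangle_mid[of "sqrt_iter Z (Suc n) x" "sqrt_iter Z m x" "sqrt_iter Z n x"]
      sqrt_iter_step[OF Z, of n x] by (simp only: left_diff_distrib)
qed simp

lemma sqrt_iter_convergent:
  assumes Z: "sym_contraction Z"
  shows "\<exists>y. ctends (\<lambda>n. sqrt_iter Z n x) y"
proof (rule cCauchy_convergent)
  fix e :: real assume e: "e > 0"
  have "convergent sqrt_bound"
    using sqrt_bound_incseq incseq_convergent[of sqrt_bound 1] sqrt_bound_range
    by (metis convergent_def)
  then have "Cauchy sqrt_bound" by (rule convergent_Cauchy)
  \<comment> \<open>The denominator \<open>1 + cnorm x\<close> stays positive also for
    \<open>x = 0\<close>.\<close>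
  then obtain N where N: "\<And>m n. m \<ge> N \<Longrightarrow> n \<ge> N \<Longrightarrow>
      \<bar>sqrt_bound m - sqrt_bound n\<bar> < e / (1 + cnorm x)"
    using e unfolding Cauchy_def dist_real_def
    by (metis add_pos_nonneg cnorm_ge_zero divide_pos_pos zero_less_one)
  have *: "cnorm (sqrt_iter Z m x - sqrt_iter Z n x) < e" if "m \<ge> N" "n \<ge> N" "n \<le> m" for m n
  proof -
    have "cnorm (sqrt_iter Z m x - sqrt_iter Z n x) \<le> (sqrt_bound m - sqrt_bound n) * cnorm x"
      by (rule sqrt_iter_diff[OF Z that(3)])
    also have "\<dots> \<le> (e / (1 + cnorm x)) * cnorm x"
      using N[OF that(1,2)] by (intro mult_right_mono) auto
    also have "\<dots> < e"
      using e by (simp add: field_simps add_pos_nonneg)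
    finally show ?thesis .
  qed
  have "cnorm (sqrt_iter Z m x - sqrt_iter Z n x) < e" if "m \<ge> N" "n \<ge> N" for m n
    using *[OF that] *[OF that(2,1)] cnorm_minus_commute[of "sqrt_iter Z m x"]
    by (metis nat_le_linear)
  then show "\<exists>N. \<forall>m\<ge>N. \<forall>n\<ge>N. cnorm (sqrt_iter Z m x - sqrt_iter Z n x) < e" by blast
qed

text \<open>Encodes \<open>0 \<le> A \<le> I\<close> through norms: by Cauchy-Schwarz, contractivity
  of \<open>I - A\<close> makes the form of \<open>A\<close> non-negative. The condition is visibly
  invariant under passing to \<open>I - A\<close>.\<close>

definition unit_op :: "('a::chilbert_space \<Rightarrow> 'a) \<Rightarrow> bool" where
  "unit_op A \<longleftrightarrow> sym_contraction A \<and> sym_contraction (\<lambda>x. x - A x)"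

lemma unit_op_compl: "unit_op A \<Longrightarrow> unit_op (\<lambda>x. x - A x)"
  by (simp add: unit_op_def)

lemma unit_op_nonneg:
  assumes "unit_op A"
  shows "0 \<le> Re (cinner x (A x))" "Im (cinner x (A x)) = 0"
proof -
  have A: "sym_contraction A" "sym_contraction (\<lambda>x. x - A x)"
    using assms by (simp_all add: unit_op_def)
  have "Re (cinner x (x - A x)) \<le> cnorm x * cnorm x"
    using Re_cinner_le[of x "x - A x"] mult_left_mono[OF sym_contractionD(2)[OF A(2), of x] cnorm_ge_zero]
      order_trans by blast
  then show "0 \<le> Re (cinner x (A x))"
    by (simp add: cinner_diff_right cnorm_sq flip: power2_eq_square)
  show "Im (cinner x (A x)) = 0"
    using Im_cinner_commute[of x "A x"] sym_contractionD(1)[OF A(1), of x x] by simp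
qed

text \<open>\<open>sqrt A = 1 - Y\<close>, where \<open>Y\<close> solves \<open>Y = (Z + Y\<^sup>2) / 2\<close> with \<open>Z = 1 - A\<close>.\<close>

lemma unit_op_sqrt:
  assumes "unit_op (A::'a::chilbert_space \<Rightarrow> 'a)"
  shows "\<exists>B. unit_op B \<and> (\<forall>x. B (B x) = A x) \<and>
    (\<forall>K. sym_contraction K \<longrightarrow> (\<forall>x. K (A x) = A (K x)) \<longrightarrow> (\<forall>x. K (B x) = B (K x)))"
proof -
  define Z where "Z = (\<lambda>x. x - A x)"
  have A: "sym_contraction A" and Z: "sym_contraction Z"
    using assms by (simp_all add: unit_op_def Z_def)
  obtain Y where Y: "\<And>x. ctends (\<lambda>n. sqrt_iter Z n x) (Y x)"
    using sqrt_iter_convergent[OF Z] by metis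
  note iter = sym_contractionD[OF sqrt_iter_sym_contraction[OF Z]]
  have symY: "sym_contraction Y"
    unfolding sym_contraction_def
  proof (intro conjI allI)
    fix x y
    have "(\<lambda>n. cinner (sqrt_iter Z n x) y) \<longlonglongrightarrow> cinner x (Y y)"
      using ctends_cinner_right[OF Y] by (simp add: iter(1))
    then show "cinner (Y x) y = cinner x (Y y)"
      using ctends_cinner_left[OF Y] LIMSEQ_unique by blast
    show "cnorm (Y x) \<le> cnorm x"
      by (rule LIMSEQ_le_const2[OF ctends_cnorm[OF Y]]) (simp add: iter(2))
  qed
  have fixY: "Y x = cscale (1/2) (Z x + Y (Y x))" for x
  proof (rule ctends_unique[OF ctends_Suc[OF Y]])
    \<comment> \<open>Both the iterate and its argument vary with \<open>n\<close>; contractivity of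
      the iterates absorbs the moving argument.\<close>
    have "ctends (\<lambda>n. sqrt_iter Z n (sqrt_iter Z n x)) (Y (Y x))"
    proof (rule ctendsI)
      show "(\<lambda>n. cnorm (sqrt_iter Z n x - Y x) + cnorm (sqrt_iter Z n (Y x) - Y (Y x))) \<longlonglongrightarrow> 0"
        using tendsto_add[OF Y[of x, unfolded ctends_iff] Y[of "Y x", unfolded ctends_iff]] by simp
      show "cnorm (sqrt_iter Z n (sqrt_iter Z n x) - Y (Y x))
        \<le> cnorm (sqrt_iter Z n x - Y x) + cnorm (sqrt_iter Z n (Y x) - Y (Y x))" for n
        using cnorm_triangle_mid[of "sqrt_iter Z n (sqrt_iter Z n x)" "Y (Y x)" "sqrt_iter Z n (Y x)"]
          iter(2)[of n "sqrt_iter Z n x - Y x"]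
        by (simp add: sym_contraction_diff[OF sqrt_iter_sym_contraction[OF Z]])
    qed
    then show "ctends (\<lambda>n. sqrt_iter Z (Suc n) x) (cscale (1/2) (Z x + Y (Y x)))"
      by (simp add: ctends_cscale ctends_add ctends_const)
  qed
  define B where "B = (\<lambda>x. x - Y x)"
  have BB: "B (B x) = A x" for x
  proof -
    have "Y x + Y x = Z x + Y (Y x)"
      by (subst (1 2) fixY) (rule cscale_half_add)
    then show ?thesis
      by (simp add: B_def Z_def sym_contraction_diff[OF symY] algebra_simps)
  qed
  have symB: "cinner (B x) y = cinner x (B y)" for x y
    by (simp add: B_def cinner_simps sym_contractionD(1)[OF symY])
  \<comment> \<open>As \<open>B\<close> is symmetric with square \<open>A\<close>, the norm bound on
    \<open>A\<close> passes to \<open>B\<close>.\<close>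
  have "cnorm (B x) \<le> cnorm x" for x
  proof (rule power2_le_imp_le)
    have "(cnorm (B x))\<^sup>2 = Re (cinner x (A x))"
      by (simp add: cnorm_sq symB BB)
    also have "\<dots> \<le> cnorm x * cnorm x"
      using Re_cinner_le[of x "A x"] mult_left_mono[OF sym_contractionD(2)[OF A, of x] cnorm_ge_zero]
        order_trans by blast
    finally show "(cnorm (B x))\<^sup>2 \<le> (cnorm x)\<^sup>2" by (simp add: power2_eq_square)
  qed simp
  then have "unit_op B"
    using symB symY by (simp add: unit_op_def sym_contraction_def B_def)
  moreover have "K (B x) = B (K x)"
    if K: "sym_contraction K" "\<forall>x. K (A x) = A (K x)" for K x
  proof -
    have "K (sqrt_iter Z n x) = sqrt_iter Z n (K x)" for n
      using K by (intro sqrt_iter_commute) (simp_all add: Z_def sym_contraction_diff)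
    then have "K (Y x) = Y (K x)"
      using ctends_unique[OF ctends_sym_contraction[OF K(1) Y[of x]]] Y[of "K x"] by simp
    then show ?thesis by (simp add: B_def sym_contraction_diff[OF K(1)])
  qed
  ultimately show ?thesis using BB by blast
qed

text \<open>With \<open>w = P y\<close>, positivity at \<open>y - w\<close> bounds the form of
  \<open>P\<close> at \<open>w\<close> below by \<open>2 * (cnorm w)\<^sup>2\<close>, while
  contractivity bounds it above by \<open>(cnorm w)\<^sup>2\<close>.\<close>

lemma sym_contraction_null:
  assumes P: "sym_contraction P" "\<And>x. 0 \<le> Re (cinner x (P x))" and "Re (cinner y (P y)) = 0"
  shows "P y = 0"
proof -
  define w where "w = P y"
  have "0 \<le> Re (cinner (y - w) (P (y - w)))" by (rule P(2))
  also have "\<dots> = Re (cinner w (P w)) - 2 * (cnorm w)\<^sup>2"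
    using assms(3) sym_contractionD(1)[OF P(1), of y w]
    by (simp add: sym_contraction_diff[OF P(1)] cinner_simps cnorm_sq flip: w_def)
  finally have "2 * (cnorm w)\<^sup>2 \<le> Re (cinner w (P w))" by simp
  also have "\<dots> \<le> cnorm w * cnorm w"
    using Re_cinner_le[of w "P w"] mult_left_mono[OF sym_contractionD(2)[OF P(1), of w] cnorm_ge_zero]
      order_trans by blast
  finally have "(cnorm w)\<^sup>2 \<le> 0" by (simp add: power2_eq_square)
  then show ?thesis by (simp add: w_def)
qed

text \<open>With \<open>y = (P - Q) x\<close>, commutativity gives
  \<open>\<langle>P y, y\<rangle> + \<langle>Q y, y\<rangle> = \<langle>(P\<^sup>2 - Q\<^sup>2) x, y\<rangle> = 0\<close>.\<close>

lemma nonneg_sqrt_unique: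
  assumes P: "sym_contraction P" "\<And>x. 0 \<le> Re (cinner x (P x))"
    and Q: "sym_contraction Q" "\<And>x. 0 \<le> Re (cinner x (Q x))"
    and PQ: "\<And>x. P (P x) = Q (Q x)" "\<And>x. P (Q x) = Q (P x)"
  shows "P x = Q x"
proof -
  define y where "y = P x - Q x"
  have "P y + Q y = 0"
    by (simp add: y_def sym_contraction_diff[OF P(1)] sym_contraction_diff[OF Q(1)] PQ)
  then have "Re (cinner y (P y)) + Re (cinner y (Q y)) = 0"
    by (metis cinner_add_right cinner_zero_right plus_complex.sel(1) zero_complex.sel(1))
  then have "Re (cinner y (P y)) = 0" "Re (cinner y (Q y)) = 0"
    using P(2)[of y] Q(2)[of y] by linarith+
  then have "P y = 0" "Q y = 0"
    by (auto intro: sym_contraction_null P Q)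
  then have "cinner y y = 0"
    by (subst y_def) (simp add: cinner_diff_left sym_contractionD(1)[OF P(1)] sym_contractionD(1)[OF Q(1)])
  then show ?thesis by (auto simp: y_def dest: cinner_eq_zero)
qed

section \<open>Square roots of unbounded operators\<close>

lemma is_linop_zero: "is_linop G \<Longrightarrow> (0, 0) \<in> G"
  by (simp add: is_linop_def)

lemma is_linop_add: "is_linop G \<Longrightarrow> (x, y) \<in> G \<Longrightarrow> (u, v) \<in> G \<Longrightarrow> (x + u, y + v) \<in> G"
  by (simp add: is_linop_def)

lemma is_linop_cscale: "is_linop G \<Longrightarrow> (x, y) \<in> G \<Longrightarrow> (cscale a x, cscale a y) \<in> G"
  by (simp add: is_linop_def)

lemma is_linop_diff: "is_linop G \<Longrightarrow> (x, y) \<in> G \<Longrightarrow> (u, v) \<in> G \<Longrightarrow> (x - u, y - v) \<in> G"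
  using is_linop_add[of G x y "- u" "- v"] is_linop_cscale[of G u v "-1"] by simp

lemma is_linop_kernel: "is_linop G \<Longrightarrow> (0, y) \<in> G \<Longrightarrow> y = 0"
  by (simp add: is_linop_def)

lemma is_linop_unique: "is_linop G \<Longrightarrow> (x, y) \<in> G \<Longrightarrow> (x, z) \<in> G \<Longrightarrow> y = z"
  using is_linop_diff[of G x y x z] is_linop_kernel[of G "y - z"] by simp

lemma app_eq: "is_linop G \<Longrightarrow> (x, y) \<in> G \<Longrightarrow> app G x = y"
  unfolding app_def by (blast intro: is_linop_unique)

lemma csubspace_graph: "is_linop G \<Longrightarrow> csubspace G"
  by (auto simp: csubspace_def zero_prod_def cscale_prod_def is_linop_def)

lemma csubspace_Domain: "is_linop G \<Longrightarrow> csubspace (Domain G)"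
  unfolding csubspace_def Domain_iff
  by (blast intro: is_linop_zero is_linop_add is_linop_cscale)

lemma is_linop_opcomp:
  assumes "is_linop G" "is_linop H"
  shows "is_linop (opcomp G H)"
  unfolding is_linop_def[of "opcomp G H"]
proof (intro conjI allI impI)
  show "(0, 0) \<in> opcomp G H"
    using assms by (auto simp: opcomp_def intro: is_linop_zero)
  show "(x + u, y + v) \<in> opcomp G H" if "(x, y) \<in> opcomp G H" "(u, v) \<in> opcomp G H" for x y u v
    using that assms by (auto simp: opcomp_def intro: is_linop_add)
  show "(cscale a x, cscale a y) \<in> opcomp G H" if "(x, y) \<in> opcomp G H" for a x y
    using that assms by (auto simp: opcomp_def intro: is_linop_cscale)
  show "y = 0" if "(0, y) \<in> opcomp G H" for y
  proof -
    obtain u where u: "(0, u) \<in> H" "(u, y) \<in> G"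
      using \<open>(0, y) \<in> opcomp G H\<close> unfolding opcomp_def by blast
    with is_linop_kernel[OF assms(2) u(1)] show ?thesis by (simp add: is_linop_kernel[OF assms(1)])
  qed
qed

section \<open>Adjoints and self-adjoint operators\<close>

lemma adjD: "(y, z) \<in> adj G \<Longrightarrow> (x, w) \<in> G \<Longrightarrow> cinner w y = cinner x z"
  by (simp add: adj_def)

lemma adjI: "(\<And>x w. (x, w) \<in> G \<Longrightarrow> cinner w y = cinner x z) \<Longrightarrow> (y, z) \<in> adj G"
  by (simp add: adj_def)

lemma adj_antimono: "G \<subseteq> H \<Longrightarrow> adj H \<subseteq> adj G"
  by (auto simp: adj_def)

lemma is_linop_adj:
  assumes "densely_defined G"
  shows "is_linop (adj G)"
  unfolding is_linop_def
proof (intro conjI allI impI)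
  fix y assume "(0, y) \<in> adj G"
  then have "cinner d y = 0" if "d \<in> Domain G" for d
    using that by (auto dest: adjD)
  then show "y = 0"
    using assms cdense_orthogonal unfolding densely_defined_def by blast
qed (auto simp: adj_def cinner_simps)

lemma closed_op_adj: "closed_op (adj G)"
  unfolding closed_op_def
proof (intro allI impI)
  fix X Y x y
  assume XY: "\<forall>n. (X n, Y n) \<in> adj G" "ctends X x" "ctends Y y"
  show "(x, y) \<in> adj G"
  proof (rule adjI)
    fix a b assume "(a, b) \<in> G"
    then have "cinner b (X n) = cinner a (Y n)" for n
      using XY(1) adjD by blast
    then show "cinner b x = cinner a y"
      using LIMSEQ_unique[OF ctends_cinner_right[OF XY(2)], of b "cinner a y"]
        ctends_cinner_right[OF XY(3)] by simp
  qed
qed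

lemma closed_opD:
  "closed_op G \<Longrightarrow> (\<And>n. (X n, Y n) \<in> G) \<Longrightarrow> ctends X x \<Longrightarrow> ctends Y y \<Longrightarrow> (x, y) \<in> G"
  unfolding closed_op_def by blast

lemma selfadjoint_opD:
  assumes "selfadjoint_op S"
  shows "is_linop S" "densely_defined S" "adj S = S" "closed_op S"
  using assms closed_op_adj[of S] by (auto simp: selfadjoint_op_def)

lemma selfadjoint_cinner:
  "selfadjoint_op S \<Longrightarrow> (x, y) \<in> S \<Longrightarrow> (u, v) \<in> S \<Longrightarrow> cinner y u = cinner x v"
  using adjD[of u v S x y] by (simp add: selfadjoint_op_def)

lemma nonneg_opD: "nonneg_op S \<Longrightarrow> (x, y) \<in> S \<Longrightarrow> 0 \<le> Re (cinner x y)"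
  by (simp add: nonneg_op_def)

text \<open>If \<open>p\<close> is orthogonal to \<open>ran (T + I)\<close>, then \<open>T p = - p\<close>, so \<open>p = 0\<close>.\<close>

lemma selfadjoint_nonneg_resolvent:
  assumes T: "selfadjoint_op T" "nonneg_op T"
  shows "\<exists>x. (x, h - x) \<in> T"
proof -
  note lin = selfadjoint_opD(1)[OF T(1)]
  define M where "M = {x + y |x y. (x, y) \<in> T}"
  have "csubspace M"
    unfolding csubspace_def
  proof (intro conjI ballI allI)
    show "0 \<in> M"
      unfolding M_def using is_linop_zero[OF lin] by force
    show "p + q \<in> M" if pq: "p \<in> M" "q \<in> M" for p q
    proof -
      obtain x y u v where "p = x + y" "(x, y) \<in> T" "q = u + v" "(u, v) \<in> T"
        using pq by (auto simp: M_def)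
      moreover from this have "p + q = (x + u) + (y + v)" by simp
      ultimately show ?thesis unfolding M_def using is_linop_add[OF lin] by blast
    qed
    show "cscale a p \<in> M" if "p \<in> M" for a p
      using that is_linop_cscale[OF lin] by (fastforce simp: M_def cscale_add_right)
  qed
  then obtain X where X: "\<And>n. X n \<in> M" "ctends X h"
  proof -
    have "p = 0" if p: "\<And>g. g \<in> M \<Longrightarrow> cinner g p = 0" for p
    proof -
      have "(p, - p) \<in> adj T"
      proof (rule adjI)
        fix x w assume "(x, w) \<in> T"
        then have "cinner (x + w) p = 0" using p by (auto simp: M_def)
        then show "cinner w p = cinner x (- p)"
          by (simp add: cinner_add_left eq_neg_iff_add_eq_0 add.commute)
      qed
      then have "(p, - p) \<in> T" using selfadjoint_opD(3)[OF T(1)] by simp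
      from nonneg_opD[OF T(2) this] have "(cnorm p)\<^sup>2 \<le> 0"
        by (simp add: cnorm_sq)
      then show ?thesis by simp
    qed
    with closure_if_orthogonal[OF \<open>csubspace M\<close>, of h] that show ?thesis
      by (metis cinner_zero_left)
  qed
  have "\<exists>x. (x, X n - x) \<in> T" for n
  proof -
    obtain x y where "X n = x + y" "(x, y) \<in> T" using X(1)[of n] by (auto simp: M_def)
    then show ?thesis by (intro exI[of _ x]) simp
  qed
  then obtain x where x: "\<And>n. (x n, X n - x n) \<in> T" by metis
  \<comment> \<open>Non-negativity makes the map from \<open>x + T x\<close> to \<open>x\<close> a
    contraction, so convergence of \<open>X\<close> carries over to the preimages, and closedness of
    \<open>T\<close> finishes the argument.\<close>
  have bound: "cnorm (x m - x n) \<le> cnorm (X m - X n)" for m n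
  proof (rule power2_le_imp_le)
    have "(x m - x n, (X m - X n) - (x m - x n)) \<in> T"
      using is_linop_diff[OF lin x[of m] x[of n]] by (simp add: algebra_simps)
    from nonneg_opD[OF T(2) this]
    have *: "0 \<le> Re (cinner (x m - x n) ((X m - X n) - (x m - x n)))" .
    have "X m - X n = (x m - x n) + ((X m - X n) - (x m - x n))" by simp
    then have "(cnorm (X m - X n))\<^sup>2 = (cnorm (x m - x n))\<^sup>2
        + 2 * Re (cinner (x m - x n) ((X m - X n) - (x m - x n)))
        + (cnorm ((X m - X n) - (x m - x n)))\<^sup>2"
      by (metis cnorm_add_sq)
    then show "(cnorm (x m - x n))\<^sup>2 \<le> (cnorm (X m - X n))\<^sup>2" using * by simp
  qed simp
  then obtain z where z: "ctends x z"
    using ctends_dominated[OF X(2)] by blast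
  have "(z, h - z) \<in> T"
    by (rule closed_opD[OF selfadjoint_opD(4)[OF T(1)] x z]) (intro ctends_diff X z)
  then show ?thesis ..
qed

text \<open>\<open>R\<close> is the resolvent at \<open>-1\<close>. The parts \<open>R p\<close> and
  \<open>p - R p = T (R p)\<close> of \<open>p\<close> have an inner product with non-negative real
  part, so neither is longer than \<open>p\<close>.\<close>

lemma selfadjoint_resolvent_op:
  assumes T: "selfadjoint_op T" "nonneg_op T"
  shows "\<exists>R. unit_op R \<and> (\<forall>p. (R p, p - R p) \<in> T) \<and> (\<forall>x y. (x, y) \<in> T \<longrightarrow> R (x + y) = x)"
proof -
  note lin = selfadjoint_opD(1)[OF T(1)]
  obtain R where R: "\<And>p. (R p, p - R p) \<in> T"
    using selfadjoint_nonneg_resolvent[OF T] by metis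
  have unique: "R (x + y) = x" if "(x, y) \<in> T" for x y
  proof -
    define d where "d = R (x + y) - x"
    have "(d, - d) \<in> T"
      using is_linop_diff[OF lin R[of "x + y"] that] by (simp add: d_def algebra_simps)
    from nonneg_opD[OF T(2) this] have "(cnorm d)\<^sup>2 \<le> 0"
      by (simp add: cnorm_sq)
    then show ?thesis by (simp add: d_def)
  qed
  have sym: "cinner (R p) q = cinner p (R q)" for p q
    using selfadjoint_cinner[OF T(1) R[of p] R[of q]] by (simp add: cinner_simps)
  have "(cnorm (R p))\<^sup>2 + (cnorm (p - R p))\<^sup>2 \<le> (cnorm p)\<^sup>2" for p
    using cnorm_add_sq[of "R p" "p - R p"] nonneg_opD[OF T(2) R[of p]] by simp
  then have "cnorm (R p) \<le> cnorm p" "cnorm (p - R p) \<le> cnorm p" for p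
    by (meson power2_le_imp_le cnorm_ge_zero le_add_same_cancel1 le_add_same_cancel2
        zero_le_power2 order_trans)+
  then have "unit_op R"
    by (simp add: unit_op_def sym_contraction_def sym cinner_simps)
  with R unique show ?thesis by blast
qed

text \<open>Surjectivity of \<open>M + I\<close> supplies density and maximality. A vector
  orthogonal to the domain vanishes; and for \<open>(y, z)\<close> in the adjoint, the solution
  \<open>x\<close> of \<open>(M + I) x = y + z\<close> differs from \<open>y\<close> by a vector
  orthogonal to the range of \<open>M + I\<close>.\<close>

lemma selfadjoint_op_if_range:
  assumes lin: "is_linop M" and nonneg: "nonneg_op M"
    and sym: "\<And>x y u v. (x, y) \<in> M \<Longrightarrow> (u, v) \<in> M \<Longrightarrow> cinner y u = cinner x v"
    and range: "\<And>h. \<exists>x. (x, h - x) \<in> M"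
  shows "selfadjoint_op M"
proof -
  have "cdense (Domain M)"
  proof (rule cdense_if_orthogonal[OF csubspace_Domain[OF lin]])
    fix g assume g: "\<And>x. x \<in> Domain M \<Longrightarrow> cinner x g = 0"
    obtain x where x: "(x, g - x) \<in> M" using range by blast
    then have "(cnorm x)\<^sup>2 \<le> 0"
      using nonneg_opD[OF nonneg x] g[of x] by (simp add: cinner_diff_right cnorm_sq DomainI)
    then show "g = 0"
      using x is_linop_kernel[OF lin, of g] by simp
  qed
  moreover have "adj M \<subseteq> M"
  proof (clarify)
    fix y z assume yz: "(y, z) \<in> adj M"
    obtain x where x: "(x, (y + z) - x) \<in> M" using range by blast
    define p where "p = y - x"
    have "cinner (a + b) p = 0" if "(a, b) \<in> M" for a b
      using adjD[OF yz that] sym[OF that x] by (simp add: p_def cinner_simps)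
    moreover obtain a where "(a, p - a) \<in> M" using range by blast
    ultimately have "cinner p p = 0" by fastforce
    then have "y = x" by (auto simp: p_def dest: cinner_eq_zero)
    with x show "(y, z) \<in> M" by simp
  qed
  moreover have "M \<subseteq> adj M" by (auto intro: adjI sym)
  ultimately show ?thesis
    using lin by (auto simp: selfadjoint_op_def densely_defined_def)
qed

text \<open>Rotation of \<open>(a, b)\<close> to \<open>(b, - a)\<close> carries the orthogonal
  complement of \<open>G\<close> into \<open>adj G\<close>. Hence the double adjoint is orthogonal
  to that complement and lies in the closure of \<open>G\<close>.\<close>

lemma adj_adj_subset:
  assumes "is_linop G" "closed_op G"
  shows "adj (adj G) \<subseteq> G"
proof clarify
  fix x y assume xy: "(x, y) \<in> adj (adj G)"
  have "cinner p (x, y) = 0" if p: "\<And>g. g \<in> G \<Longrightarrow> cinner g p = 0" for p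
  proof -
    have "(snd p, - fst p) \<in> adj G"
    proof (rule adjI)
      fix a b assume "(a, b) \<in> G"
      from p[OF this] show "cinner b (snd p) = cinner a (- fst p)"
        by (simp add: cinner_prod_def eq_neg_iff_add_eq_0 add.commute)
    qed
    from adjD[OF xy this] show ?thesis
      by (simp add: cinner_prod_def neg_eq_iff_add_eq_0)
  qed
  then obtain X where X: "\<And>n. X n \<in> G" "ctends X (x, y)"
    using closure_if_orthogonal[OF csubspace_graph[OF assms(1)]] by metis
  show "(x, y) \<in> G"
    by (rule closed_opD[OF assms(2) _ ctends_PairD[OF X(2)]]) (simp add: X(1))
qed

text \<open>Projecting \<open>(h, 0)\<close> onto the graph of \<open>G\<^sup>*\<close> solves \<open>(I + G G\<^sup>*) x = h\<close>.\<close>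

lemma von_neumann_selfadjoint:
  assumes G: "is_linop G" "closed_op G" "densely_defined G"
  shows "selfadjoint_op (opcomp G (adj G)) \<and> nonneg_op (opcomp G (adj G))"
proof -
  have form: "cinner z x' = cinner y y'"
    if "(y, z) \<in> G" "(x', y') \<in> adj G" for x' y y' z
    using adjD[OF that(2,1)] .
  have nonneg: "nonneg_op (opcomp G (adj G))"
    unfolding nonneg_op_def
  proof (intro allI impI)
    fix x z assume "(x, z) \<in> opcomp G (adj G)"
    then obtain y where "(x, y) \<in> adj G" "(y, z) \<in> G" by (auto simp: opcomp_def)
    then have "cinner z x = cinner y y" by (rule form[rotated])
    then show "Im (cinner x z) = 0 \<and> 0 \<le> Re (cinner x z)"
      using Re_cinner_commute[of x z] Im_cinner_commute[of x z] by (simp add: cinner_nonneg)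
  qed
  moreover have "selfadjoint_op (opcomp G (adj G))"
  proof (rule selfadjoint_op_if_range[OF is_linop_opcomp[OF G(1) is_linop_adj[OF G(3)]] nonneg])
    fix x z x' z' assume "(x, z) \<in> opcomp G (adj G)" "(x', z') \<in> opcomp G (adj G)"
    then obtain y y' where y: "(x, y) \<in> adj G" "(y, z) \<in> G" "(x', y') \<in> adj G" "(y', z') \<in> G"
      by (auto simp: opcomp_def)
    have "cinner z x' = cinner y y'" "cinner z' x = cinner y' y"
      using form y by blast+
    then show "cinner z x' = cinner x z'"
      by (metis cinner_cnj)
  next
    fix h
    obtain X m where X: "\<And>n. X n \<in> adj G" "ctends X m"
      and m: "\<And>g. g \<in> adj G \<Longrightarrow> cinner g ((h, 0) - m) = 0"
      using projection[OF csubspace_graph[OF is_linop_adj[OF G(3)]]] by metis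
    obtain x y where xy: "m = (x, y)" by force
    have "(x, y) \<in> adj G"
      by (rule closed_opD[OF closed_op_adj _ ctends_PairD[OF X(2)[unfolded xy]]]) (simp add: X(1))
    \<comment> \<open>Orthogonality of the residual to \<open>adj G\<close> says exactly that the
      double adjoint, which is contained in \<open>G\<close>, maps \<open>y\<close> to
      \<open>h - x\<close>.\<close>
    moreover have "(y, h - x) \<in> adj (adj G)"
    proof (rule adjI)
      fix a b assume "(a, b) \<in> adj G"
      from m[OF this] show "cinner b y = cinner a (h - x)"
        by (simp add: cinner_prod_def xy)
    qed
    ultimately show "\<exists>x. (x, h - x) \<in> opcomp G (adj G)"
      using adj_adj_subset[OF G(1,2)] by (auto simp: opcomp_def)
  qed
  ultimately show ?thesis by simp
qed

text \<open>For existence, \<open>S\<close> sends \<open>B x\<close> to \<open>C x\<close>. For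
  uniqueness, a further root \<open>S'\<close> is encoded by the bounded operator
  \<open>K = S' R\<close>, which has to be \<open>B C\<close>, the non-negative root of
  \<open>R (I - R)\<close>.\<close>

lemma selfadjoint_sqrt_unique_exists:
  assumes T: "selfadjoint_op T" "nonneg_op T"
  shows "\<exists>!S. selfadjoint_op S \<and> nonneg_op S \<and> opcomp S S = T"
proof -
  note linT = selfadjoint_opD(1)[OF T(1)]
  obtain R where R: "unit_op R" "\<And>p. (R p, p - R p) \<in> T" "\<And>x y. (x, y) \<in> T \<Longrightarrow> R (x + y) = x"
    using selfadjoint_resolvent_op[OF T] by blast
  have symR: "sym_contraction R" using R(1) by (simp add: unit_op_def)
  obtain B where B: "unit_op B" "\<And>x. B (B x) = R x"
    and B_comm: "\<And>K x. sym_contraction K \<Longrightarrow> (\<And>x. K (R x) = R (K x)) \<Longrightarrow> K (B x) = B (K x)"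
    using unit_op_sqrt[OF R(1)] by blast
  obtain C where C: "unit_op C" "\<And>x. C (C x) = x - R x"
    and C_comm': "\<And>K x. sym_contraction K \<Longrightarrow> (\<And>x. K (x - R x) = K x - R (K x)) \<Longrightarrow> K (C x) = C (K x)"
    using unit_op_sqrt[OF unit_op_compl[OF R(1)]] by blast
  have C_comm: "K (C x) = C (K x)" if "sym_contraction K" "\<And>x. K (R x) = R (K x)" for K x
    using that by (intro C_comm') (simp_all add: sym_contraction_diff)
  have symB: "sym_contraction B" and symC: "sym_contraction C"
    using B(1) C(1) by (simp_all add: unit_op_def)
  \<comment> \<open>\<open>C\<close> commutes with its own square \<open>I - R\<close>.\<close>
  have CR: "C (R x) = R (C x)" for x
  proof -
    have "C (C (C x)) = C (x - R x)" by (simp only: C(2))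
    then show ?thesis using C(2)[of "C x"] by (simp add: sym_contraction_diff[OF symC])
  qed
  have CB: "C (B x) = B (C x)" for x
    by (rule B_comm[OF symC CR])
  \<comment> \<open>A root \<open>D\<close> of \<open>B\<close> rewrites the form of
    \<open>B C\<close> as the form of \<open>C\<close> at \<open>D x\<close>, which shows its
    sign.\<close>
  obtain D where D: "unit_op D" "\<And>x. D (D x) = B x"
    and D_comm: "\<And>K x. sym_contraction K \<Longrightarrow> (\<And>x. K (B x) = B (K x)) \<Longrightarrow> K (D x) = D (K x)"
    using unit_op_sqrt[OF B(1)] by blast
  have symD: "sym_contraction D" using D(1) by (simp add: unit_op_def)
  have BC_form: "cinner x (B (C x)) = cinner (D x) (C (D x))" for x
    by (simp add: sym_contractionD(1)[OF symD] D_comm[OF symC CB] flip: D(2))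
  \<comment> \<open>\<open>B x = 0\<close> gives \<open>R x = 0\<close>, so that
    \<open>(0, x)\<close> lies in \<open>T\<close>.\<close>
  have B_inj: "x = 0" if "B x = 0" for x
    using R(2)[of x] that B(2)[of x] is_linop_kernel[OF linT, of x]
    by (simp add: sym_contraction_zero[OF symB])
  \<comment> \<open>The equation \<open>C y = B z\<close> makes linearity immediate. Since
    \<open>B^2 + C^2 = I\<close>, it also describes the pairs \<open>(B x, C x)\<close>, with
    parameter \<open>x = B y + C z\<close>.\<close>
  define S where "S = {(y, z). C y = B z}"
  have S_iff: "(y, z) \<in> S \<longleftrightarrow> (\<exists>x. y = B x \<and> z = C x)" for y z
  proof
    assume "(y, z) \<in> S"
    then have yz: "C y = B z" by (simp add: S_def)
    have "B (B y + C z) = y"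
      by (simp add: sym_contraction_add[OF symB] B(2) C(2) flip: CB yz)
    moreover have "C (B y + C z) = z"
      by (simp add: sym_contraction_add[OF symC] CB yz B(2) C(2))
    ultimately show "\<exists>x. y = B x \<and> z = C x" by metis
  qed (auto simp: S_def CB)
  have linS: "is_linop S"
    unfolding is_linop_def
    by (auto simp: S_def sym_contraction_add[OF symB] sym_contraction_add[OF symC]
        sym_contraction_cscale[OF symB] sym_contraction_cscale[OF symC]
        sym_contraction_zero[OF symB] sym_contraction_zero[OF symC] intro: B_inj)
  \<comment> \<open>Tested on the pairs \<open>(B x, C x)\<close>, the adjoint condition becomes
    \<open>C y = B z\<close> once \<open>B\<close> and \<open>C\<close> are moved across the inner
    product.\<close>
  have adjS: "adj S = S"
  proof -
    have "(y, z) \<in> adj S \<longleftrightarrow> (\<forall>x. cinner (C x) y = cinner (B x) z)" for y z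
      unfolding adj_def S_iff mem_Collect_eq case_prod_conv by blast
    also have "\<dots> y z \<longleftrightarrow> (\<forall>x. cinner x (C y) = cinner x (B z))" for y z
      by (simp add: sym_contractionD(1)[OF symB] sym_contractionD(1)[OF symC])
    also have "\<dots> y z \<longleftrightarrow> (y, z) \<in> S" for y z
      by (auto simp: S_def intro: cinner_ext)
    finally show ?thesis by auto
  qed
  have "cdense (Domain S)"
  proof (rule cdense_if_orthogonal[OF csubspace_Domain[OF linS]])
    fix g assume g: "\<And>x. x \<in> Domain S \<Longrightarrow> cinner x g = 0"
    have "cinner x (B g) = 0" for x
      using g[of "B x"] S_iff by (auto simp: sym_contractionD(1)[OF symB])
    then show "g = 0" by (rule B_inj[OF cinner_eq_zero])
  qed
  with linS adjS have saS: "selfadjoint_op S"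
    by (simp add: selfadjoint_op_def densely_defined_def)
  have "nonneg_op S"
    unfolding nonneg_op_def S_iff
    by (clarsimp simp only: sym_contractionD(1)[OF symB] BC_form unit_op_nonneg[OF C(1)] simp_thms)
  moreover have "opcomp S S = T"
  proof (intro equalityI subrelI)
    fix u v assume "(u, v) \<in> opcomp S S"
    then obtain x x' where x: "u = B x" "C x = B x'" "v = C x'"
      by (auto simp: opcomp_def S_iff)
    have "x = B (B x) + C (C x)" by (simp add: B(2) C(2))
    also have "\<dots> = B (u + v)"
      by (simp add: x CB sym_contraction_add[OF symB])
    finally have "R (u + v) = u" by (simp add: x(1) flip: B(2))
    with R(2)[of "u + v"] show "(u, v) \<in> T" by simp
  next
    fix u v assume uv: "(u, v) \<in> T"
    define p where "p = u + v"
    have "u = R p" "v = p - R p" using R(3)[OF uv] by (simp_all add: p_def)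
    then have "u = B (B p)" "v = C (C p)" by (simp_all add: B(2) C(2))
    then show "(u, v) \<in> opcomp S S"
      using CB[of p] by (auto simp: opcomp_def S_iff)
  qed
  moreover have "S' = S" if S': "selfadjoint_op S'" "nonneg_op S'" "opcomp S' S' = T" for S'
  proof -
    note lin = selfadjoint_opD(1)[OF S'(1)]
    have "\<exists>k. (R p, k) \<in> S' \<and> (k, p - R p) \<in> S'" for p
      using R(2)[of p] S'(3) by (auto simp: opcomp_def)
    then obtain K where K: "\<And>p. (R p, K p) \<in> S'" "\<And>p. (K p, p - R p) \<in> S'" by metis
    \<comment> \<open>\<open>S' S' = T\<close> maps \<open>K y\<close> to \<open>z - K y\<close>, so
      the resolvent sends \<open>z\<close> to \<open>K y\<close>. Applied to the two families in
      \<open>K\<close>, this yields commutation with \<open>R\<close> and the square of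
      \<open>K\<close>.\<close>
    have K_S': "K y = R z" if "(y, z) \<in> S'" for y z
    proof -
      have "(y - R y, z - K y) \<in> S'"
        by (rule is_linop_diff[OF lin that K(1)])
      then have "(K y, z - K y) \<in> T"
        using K(2)[of y] S'(3) by (auto simp: opcomp_def)
      from R(3)[OF this] show ?thesis by simp
    qed
    have KR: "K (R p) = R (K p)" and KK: "K (K p) = R (p - R p)" for p
      by (rule K_S'[OF K(1)], rule K_S'[OF K(2)])
    \<comment> \<open>Splitting \<open>q\<close> into \<open>R q\<close> and \<open>q - R q\<close>,
      symmetry of \<open>S'\<close> moves each summand to the \<open>p\<close> side.\<close>
    have "cinner (K p) q = cinner p (K q)" for p q
      using selfadjoint_cinner[OF S'(1) K(1)[of p] K(2)[of q]]
        selfadjoint_cinner[OF S'(1) K(1)[of p] K(1)[of q]]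
        selfadjoint_cinner[OF S'(1) K(2)[of p] K(2)[of q]]
        selfadjoint_cinner[OF S'(1) K(2)[of p] K(1)[of q]]
      by (simp add: cinner_simps)
    moreover have "cnorm (K p) \<le> cnorm p" for p
    proof (rule power2_le_imp_le)
      have "Re (cinner (R p) (p - R p)) = (cnorm (K p))\<^sup>2"
        using selfadjoint_cinner[OF S'(1) K(1)[of p] K(2)[of p]] by (simp add: cnorm_sq)
      then have "(cnorm p)\<^sup>2 = (cnorm (R p))\<^sup>2 + 2 * (cnorm (K p))\<^sup>2 + (cnorm (p - R p))\<^sup>2"
        using cnorm_add_sq[of "R p" "p - R p"] by simp
      then show "(cnorm (K p))\<^sup>2 \<le> (cnorm p)\<^sup>2"
        by (simp add: add_increasing add_increasing2)
    qed simp
    ultimately have symK: "sym_contraction K" by (simp add: sym_contraction_def)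
    \<comment> \<open>The same splitting of \<open>p\<close> writes the form of \<open>K\<close> as
      a sum of two values of the form of \<open>S'\<close>.\<close>
    have K_nonneg: "0 \<le> Re (cinner p (K p))" for p
    proof -
      have "Re (cinner p (K p)) = Re (cinner (R p) (K p)) + Re (cinner (K p) (p - R p))"
        using Re_cinner_commute[of "K p" "p - R p"] by (simp add: cinner_simps)
      then show ?thesis
        using nonneg_opD[OF S'(2) K(1)[of p]] nonneg_opD[OF S'(2) K(2)[of p]] by simp
    qed
    have symBC: "sym_contraction (\<lambda>x. B (C x))"
      unfolding sym_contraction_def
      by (auto simp: sym_contractionD(1)[OF symB] sym_contractionD(1)[OF symC] CB
          intro: order_trans sym_contractionD(2)[OF symB] sym_contractionD(2)[OF symC])
    \<comment> \<open>Both operators are non-negative, they commute, and each has square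
      \<open>R (I - R)\<close>.\<close>
    have K_eq: "K x = B (C x)" for x
    proof (rule nonneg_sqrt_unique[OF symK K_nonneg symBC])
      show "0 \<le> Re (cinner x (B (C x)))" for x
        by (simp add: BC_form unit_op_nonneg[OF C(1)])
      show "K (K x) = B (C (B (C x)))" for x
        by (simp add: KK CB) (simp add: B(2) C(2))
      show "K (B (C x)) = B (C (K x))" for x
        by (simp add: B_comm[OF symK KR] C_comm[OF symK KR])
    qed
    \<comment> \<open>One inclusion suffices, because taking adjoints reverses it and fixes both
      operators.\<close>
    have "S' \<subseteq> S"
    proof clarify
      fix y z assume "(y, z) \<in> S'"
      then have "B (C y) = B (B z)"
        using K_S' by (simp add: B(2) flip: K_eq)
      then have "B (C y - B z) = 0"
        by (simp add: sym_contraction_diff[OF symB])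
      from B_inj[OF this] show "(y, z) \<in> S" by (simp add: S_def)
    qed
    with adj_antimono[OF this] show ?thesis
      using adjS selfadjoint_opD(3)[OF S'(1)] by blast
  qed
  ultimately show ?thesis using saS by blast
qed

lemma op_sqrt:
  assumes "selfadjoint_op T" "nonneg_op T"
  shows "selfadjoint_op (op_sqrt T)" "nonneg_op (op_sqrt T)" "opcomp (op_sqrt T) (op_sqrt T) = T"
  using theI'[OF selfadjoint_sqrt_unique_exists[OF assms]] by (simp_all add: op_sqrt_def)

section \<open>The operator \<open>Ld L\<close> for a closed restriction \<open>Ld\<close> of \<open>L\<close>\<close>

text \<open>Equal norms make the \<open>A\<close>-images converge whenever the
  \<open>L\<close>-images do. Closedness of \<open>A\<close> then keeps the limit in
  \<open>Domain A\<close>, and closedness of \<open>L\<close> identifies its image.\<close>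

lemma op_restrict_isometric:
  assumes L: "selfadjoint_op L" and A: "selfadjoint_op A"
    and sub: "Domain A \<subseteq> Domain L"
    and nrm: "\<forall>g\<in>Domain A. cnorm (app A g) = cnorm (app L g)"
  shows "is_linop (op_restrict L (Domain A))" "closed_op (op_restrict L (Domain A))"
    "densely_defined (op_restrict L (Domain A))" "symmetric_op (op_restrict L (Domain A))"
proof -
  note linL = selfadjoint_opD(1)[OF L] and linA = selfadjoint_opD(1)[OF A]
  let ?Ld = "op_restrict L (Domain A)"
  have dom: "Domain ?Ld = Domain A" using sub by (auto simp: op_restrict_def)
  show lin: "is_linop ?Ld"
    using linL csubspace_Domain[OF linA]
    unfolding is_linop_def csubspace_def op_restrict_def by simp
  show dense: "densely_defined ?Ld"
    using selfadjoint_opD(2)[OF A] by (simp add: densely_defined_def dom)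
  have "?Ld \<subseteq> L" by (auto simp: op_restrict_def)
  then have "?Ld \<subseteq> adj ?Ld"
    using adj_antimono[of ?Ld L] selfadjoint_opD(3)[OF L] by blast
  then show "symmetric_op ?Ld" using lin dense by (simp add: symmetric_op_def)
  show "closed_op ?Ld"
    unfolding closed_op_def
  proof (intro allI impI)
    fix X Y x y
    assume XY: "\<forall>n. (X n, Y n) \<in> ?Ld" "ctends X x" "ctends Y y"
    have XY_L: "(X n, Y n) \<in> L" for n using XY(1) by (simp add: op_restrict_def)
    have "\<exists>w. (X n, w) \<in> A" for n using XY(1) by (auto simp: op_restrict_def)
    then obtain W where W: "\<And>n. (X n, W n) \<in> A" by metis
    have "cnorm (W m - W n) \<le> cnorm (Y m - Y n)" for m n
    proof -
      have WA: "(X m - X n, W m - W n) \<in> A" by (rule is_linop_diff[OF linA W W])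
      have "(X m - X n, Y m - Y n) \<in> L" by (rule is_linop_diff[OF linL XY_L XY_L])
      with WA nrm show ?thesis
        by (metis DomainI app_eq[OF linA] app_eq[OF linL] order_refl)
    qed
    then obtain w where "ctends W w" using ctends_dominated[OF XY(3)] by blast
    then have "(x, w) \<in> A" by (rule closed_opD[OF selfadjoint_opD(4)[OF A] W XY(2)])
    moreover have "(x, y) \<in> L" by (rule closed_opD[OF selfadjoint_opD(4)[OF L] XY_L XY(2,3)])
    ultimately show "(x, y) \<in> ?Ld" by (auto simp: op_restrict_def)
  qed
qed

text \<open>The setting of claims (5), (6), (8) and (9) for a single restriction;
  \<open>Ld = L\<close> is allowed and is used for claim (7).\<close>

locale closed_restriction =
  fixes L Ld :: "('a::chilbert_space \<times> 'a) set"
  assumes L: "selfadjoint_op L" "nonneg_op L" "Range L = UNIV"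
    and Ld: "is_linop Ld" "closed_op Ld" "densely_defined Ld" "Ld \<subseteq> L"
begin

lemmas linL = selfadjoint_opD(1)[OF L(1)]

text \<open>A kernel vector is orthogonal to the range, which is the whole space.\<close>

lemma L_inj: "(x, 0) \<in> L \<Longrightarrow> x = 0"
proof -
  assume x: "(x, 0) \<in> L"
  obtain u where "(u, x) \<in> L" using L(3) by blast
  from selfadjoint_cinner[OF L(1) x this] show ?thesis
    by (auto intro: cinner_eq_zero)
qed

lemma L_inj': "(x, y) \<in> L \<Longrightarrow> (x', y) \<in> L \<Longrightarrow> x = x'"
  using L_inj[of "x - x'"] is_linop_diff[OF linL, of x y x' y] by simp

text \<open>The inverse of \<open>L\<close>, a total function because \<open>L\<close> is bijective
  from its domain onto the space.\<close>

definition V :: "'a \<Rightarrow> 'a" where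
  "V y = (THE x. (x, y) \<in> L)"

lemma V_eq: "(x, y) \<in> L \<Longrightarrow> V y = x"
  unfolding V_def by (blast intro: L_inj')

lemma V_in: "(V y, y) \<in> L"
  using L(3) V_eq by blast

lemma V_sym: "cinner (V x) y = cinner x (V y)"
  using selfadjoint_cinner[OF L(1) V_in[of x] V_in[of y]] by simp

lemma V_add: "V (x + y) = V x + V y"
  by (intro V_eq is_linop_add[OF linL] V_in)

abbreviation "A \<equiv> opcomp Ld L"

lemma V_A: "(d, z) \<in> Ld \<Longrightarrow> (V d, z) \<in> A"
  using V_in by (auto simp: opcomp_def)

lemma A_iff: "(x, z) \<in> A \<longleftrightarrow> (\<exists>d. (d, z) \<in> Ld \<and> x = V d)"
  using V_eq V_A by (auto simp: opcomp_def)

text \<open>The form of \<open>A\<close> at \<open>V d\<close> is the squared norm of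
  \<open>d\<close>; both extremality proofs rest on this.\<close>

lemma A_form:
  assumes "(d, z) \<in> Ld"
  shows "cinner (V d) z = cinner d d"
  using assms Ld(4) selfadjoint_cinner[OF L(1) V_in[of d], of d z] by auto

lemma Domain_A: "Domain A = V ` Domain Ld"
  unfolding set_eq_iff image_iff Domain_iff A_iff Bex_def by blast

lemma Ld_orthogonal: "(\<And>d. d \<in> Domain Ld \<Longrightarrow> cinner d p = 0) \<Longrightarrow> p = 0"
  using Ld(3) cdense_orthogonal unfolding densely_defined_def by blast

text \<open>If \<open>p\<close> is orthogonal to \<open>V d\<close> for all \<open>d\<close> in
  \<open>Domain Ld\<close>, then \<open>V p\<close> is orthogonal to a dense set, and
  \<open>p = L (V p)\<close> vanishes.\<close>

lemma A_densely_defined: "densely_defined A"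
  unfolding densely_defined_def
proof (rule cdense_if_orthogonal[OF csubspace_Domain[OF is_linop_opcomp[OF Ld(1) linL]]])
  fix p assume "\<And>g. g \<in> Domain A \<Longrightarrow> cinner g p = 0"
  then have "cinner d (V p) = 0" if "d \<in> Domain Ld" for d
    using that by (simp add: Domain_A flip: V_sym)
  then have "V p = 0" by (rule Ld_orthogonal)
  then show "p = 0"
    using V_in[of p] is_linop_kernel[OF linL] by simp
qed

lemma A_symmetric: "symmetric_op A"
proof -
  have "A \<subseteq> adj A"
  proof (clarsimp simp: adj_def)
    fix x z x' z' assume "(x, z) \<in> A" "(x', z') \<in> A"
    then obtain d d' where d: "(d, z) \<in> Ld" "x = V d" "(d', z') \<in> Ld" "x' = V d'"
      by (auto simp: A_iff)
    then have "(d, z) \<in> L" "(d', z') \<in> L" using Ld(4) by auto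
    then show "cinner z' x = cinner x' z"
      using selfadjoint_cinner[OF L(1) _ V_in, of d' z' d] selfadjoint_cinner[OF L(1) V_in, of d z d'] d
      by simp
  qed
  then show ?thesis
    using A_densely_defined is_linop_opcomp[OF Ld(1) linL] by (simp add: symmetric_op_def)
qed

lemma A_nonneg: "nonneg_op A"
  by (auto simp: nonneg_op_def A_iff A_form cinner_nonneg)

lemma L_subset_adj: "L \<subseteq> adj Ld"
  using adj_antimono[OF Ld(4)] selfadjoint_opD(3)[OF L(1)] by blast

text \<open>For \<open>(y, z)\<close> in \<open>adj A\<close>, moving \<open>V\<close> from
  \<open>V d\<close> onto \<open>z\<close> exhibits \<open>(y, V z)\<close> as an element of
  \<open>adj Ld\<close>, and \<open>L\<close> maps \<open>V z\<close> to \<open>z\<close>.\<close>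

lemma adj_A: "adj A = opcomp L (adj Ld)"
proof (intro equalityI subrelI)
  fix y z assume yz: "(y, z) \<in> adj A"
  have "(y, V z) \<in> adj Ld"
    by (rule adjI) (simp add: adjD[OF yz V_A] flip: V_sym)
  then show "(y, z) \<in> opcomp L (adj Ld)"
    using V_in by (auto simp: opcomp_def)
next
  fix y z assume "(y, z) \<in> opcomp L (adj Ld)"
  then obtain w where w: "(y, w) \<in> adj Ld" "(w, z) \<in> L" by (auto simp: opcomp_def)
  show "(y, z) \<in> adj A"
  proof (rule adjI)
    fix x v assume "(x, v) \<in> A"
    then obtain d where d: "(x, d) \<in> L" "(d, v) \<in> Ld" by (auto simp: opcomp_def)
    show "cinner v y = cinner x z"
      using adjD[OF w(1) d(2)] selfadjoint_cinner[OF L(1) d(1) w(2)] by simp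
  qed
qed

text \<open>A pair \<open>p\<close> orthogonal to all \<open>(V d, d)\<close> satisfies
  \<open>V (fst p) + snd p = 0\<close> by density of \<open>Domain Ld\<close>, and is then
  orthogonal to the whole graph of \<open>L\<close>.\<close>

lemma graph_core:
  assumes "(x, y) \<in> L"
  shows "\<exists>D. (\<forall>n. D n \<in> Domain Ld) \<and> ctends (\<lambda>n. V (D n)) x \<and> ctends D y"
proof -
  define M where "M = {(V d, d) |d. d \<in> Domain Ld}"
  have M_eq: "M = {(x, y) \<in> L. y \<in> Domain Ld}"
    using V_in V_eq by (auto simp: M_def)
  have "csubspace M"
    using linL csubspace_Domain[OF Ld(1)] unfolding M_eq
    by (auto simp: csubspace_def is_linop_def zero_prod_def cscale_prod_def)
  moreover have "cinner p (x, y) = 0" if p: "\<And>g. g \<in> M \<Longrightarrow> cinner g p = 0" for p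
  proof -
    have "V (fst p) + snd p = 0"
    proof (rule Ld_orthogonal)
      fix d assume "d \<in> Domain Ld"
      then have "cinner (V d, d) p = 0" by (intro p) (auto simp: M_def)
      then show "cinner d (V (fst p) + snd p) = 0"
        by (simp add: cinner_prod_def cinner_add_right V_sym)
    qed
    then have "snd p = - V (fst p)" by (simp add: eq_neg_iff_add_eq_0 add.commute)
    then show ?thesis by (simp add: cinner_prod_def V_sym V_eq[OF assms])
  qed
  ultimately obtain X where X: "\<And>n. X n \<in> M" "ctends X (x, y)"
    using closure_if_orthogonal by metis
  have "fst (X n) = V (snd (X n)) \<and> snd (X n) \<in> Domain Ld" for n
    using X(1)[of n] by (auto simp: M_def)
  with ctends_PairD[OF X(2)] show ?thesis by (intro exI[of _ "\<lambda>n. snd (X n)"]) simp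
qed

text \<open>The form of any extension \<open>C\<close> agrees with that of \<open>L\<^sup>2\<close> on \<open>dom A\<close>, which is a form core,
  and \<open>\<langle>h, (C + a)\<^sup>-\<^sup>1 h\<rangle>\<close> is the supremum of \<open>2 Re \<langle>h, w\<rangle> - \<langle>(C + a) w, w\<rangle>\<close>.\<close>

lemma friedrichs: "is_friedrichs_ext A (opcomp L L)"
proof -
  have saT: "selfadjoint_op (opcomp L L)" "nonneg_op (opcomp L L)"
    using von_neumann_selfadjoint[OF linL selfadjoint_opD(4,2)[OF L(1)]] selfadjoint_opD(3)[OF L(1)]
    by simp_all
  have "A \<subseteq> opcomp L L" using Ld(4) by (auto simp: opcomp_def)
  moreover have "resolvent_le (opcomp L L) C a" if C: "nonneg_sa_ext A C" and a: "a > 0" for C a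
    unfolding resolvent_le_def
  proof (intro allI impI)
    fix x1 y1 x2 y2
    assume 1: "(x1, y1) \<in> opcomp L L" and 2: "(x2, y2) \<in> C"
      and eq: "y1 + cscale (complex_of_real a) x1 = y2 + cscale (complex_of_real a) x2"
    define h where "h = y2 + cscale (complex_of_real a) x2"
    have saC: "selfadjoint_op C" "nonneg_op C" "A \<subseteq> C" using C by (simp_all add: nonneg_sa_ext_def)
    obtain q where q: "(x1, q) \<in> L" "(q, y1) \<in> L" using 1 by (auto simp: opcomp_def)
    have h1: "Re (cinner h x1) = (cnorm q)\<^sup>2 + a * (cnorm x1)\<^sup>2"
      using selfadjoint_cinner[OF L(1) q(2) q(1)]
      by (simp add: h_def cinner_simps cnorm_sq flip: eq)
    \<comment> \<open>The form of \<open>C + a\<close> is non-negative at \<open>x2 - V d\<close>.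
      Rewriting the mixed terms through \<open>h\<close> leaves a lower bound in terms of
      \<open>L\<close> alone.\<close>
    have bound: "2 * Re (cinner q d) - (cnorm d)\<^sup>2 + a * (2 * Re (cinner x1 (V d)) - (cnorm (V d))\<^sup>2)
        \<le> Re (cinner h x2)" if "d \<in> Domain Ld" for d
    proof -
      obtain z where z: "(d, z) \<in> Ld" using \<open>d \<in> Domain Ld\<close> by auto
      let ?w = "V d"
      have wC: "(?w, z) \<in> C" using V_A[OF z] saC(3) by auto
      have "0 \<le> Re (cinner (x2 - ?w) (y2 - z)) + a * (cnorm (x2 - ?w))\<^sup>2"
        using nonneg_opD[OF saC(2) is_linop_diff[OF selfadjoint_opD(1)[OF saC(1)] 2 wC]] a by simp
      moreover have "Re (cinner x2 z) = Re (cinner ?w y2)"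
        using selfadjoint_cinner[OF saC(1) 2 wC] Re_cinner_commute[of ?w y2] by simp
      moreover have "Re (cinner ?w z) = (cnorm d)\<^sup>2"
        by (simp add: A_form[OF z] cnorm_sq)
      moreover have "Re (cinner ?w y2) + a * Re (cinner x2 ?w) = Re (cinner q d) + a * Re (cinner x1 ?w)"
      proof -
        have "Re (cinner ?w y2) + a * Re (cinner x2 ?w) = Re (cinner ?w h)"
          using Re_cinner_commute[of x2 ?w] by (simp add: h_def cinner_simps)
        also have "\<dots> = Re (cinner ?w y1) + a * Re (cinner x1 ?w)"
          using Re_cinner_commute[of x1 ?w] by (simp add: h_def cinner_simps flip: eq)
        also have "Re (cinner ?w y1) = Re (cinner q d)"
          using selfadjoint_cinner[OF L(1) V_in[of d] q(2)] Re_cinner_commute[of q d] by simp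
        finally show ?thesis .
      qed
      moreover have "Re (cinner h x2) = Re (cinner x2 y2) + a * (cnorm x2)\<^sup>2"
        using Re_cinner_commute[of x2 y2] by (simp add: h_def cinner_simps cnorm_sq)
      ultimately show ?thesis
        by (simp add: cinner_diff_left cinner_diff_right cnorm_diff_sq algebra_simps)
    qed
    \<comment> \<open>Approximating \<open>(x1, q)\<close> in the graph of \<open>L\<close> drives
      the lower bound to the value found in \<open>h1\<close>.\<close>
    obtain D where D: "\<And>n. D n \<in> Domain Ld" "ctends (\<lambda>n. V (D n)) x1" "ctends D q"
      using graph_core[OF q(1)] by blast
    have "(\<lambda>n. 2 * Re (cinner q (D n)) - (cnorm (D n))\<^sup>2
          + a * (2 * Re (cinner x1 (V (D n))) - (cnorm (V (D n)))\<^sup>2))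
        \<longlonglongrightarrow> 2 * Re (cinner q q) - (cnorm q)\<^sup>2 + a * (2 * Re (cinner x1 x1) - (cnorm x1)\<^sup>2)"
      by (intro tendsto_intros ctends_cinner_right ctends_cnorm D)
    then have "2 * Re (cinner q q) - (cnorm q)\<^sup>2 + a * (2 * Re (cinner x1 x1) - (cnorm x1)\<^sup>2)
        \<le> Re (cinner h x2)"
      by (rule LIMSEQ_le_const2) (use bound[OF D(1)] in blast)
    then show "Re (cinner (y1 + cscale (complex_of_real a) x1) x1)
        \<le> Re (cinner (y2 + cscale (complex_of_real a) x2) x2)"
      using h1 by (simp add: eq flip: h_def cnorm_sq)
  qed
  ultimately show ?thesis
    using saT by (simp add: is_friedrichs_ext_def nonneg_sa_ext_def)
qed

text \<open>Every extension \<open>C\<close> satisfies \<open>C \<subseteq> A\<^sup>* = L Ld\<^sup>*\<close>; testing \<open>C \<ge> 0\<close> on \<open>v - V d\<close> and letting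
  \<open>d\<close> tend to \<open>Ld\<^sup>* v\<close> bounds the form of \<open>Ld Ld\<^sup>*\<close> by that of \<open>C\<close>.\<close>

lemma krein: "is_krein_ext A (opcomp Ld (adj Ld))"
proof -
  have "A \<subseteq> opcomp Ld (adj Ld)" using L_subset_adj by (auto simp: opcomp_def)
  moreover have "resolvent_le C (opcomp Ld (adj Ld)) a" if C: "nonneg_sa_ext A C" and a: "a > 0" for C a
    unfolding resolvent_le_def
  proof (intro allI impI)
    fix v y1 k y2
    assume 1: "(v, y1) \<in> C" and 2: "(k, y2) \<in> opcomp Ld (adj Ld)"
      and eq: "y1 + cscale (complex_of_real a) v = y2 + cscale (complex_of_real a) k"
    define h where "h = y2 + cscale (complex_of_real a) k"
    have saC: "selfadjoint_op C" "nonneg_op C" "A \<subseteq> C" using C by (simp_all add: nonneg_sa_ext_def)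
    have "C \<subseteq> adj A" using adj_antimono[OF saC(3)] selfadjoint_opD(3)[OF saC(1)] by simp
    then obtain g where g: "(v, g) \<in> adj Ld" "(g, y1) \<in> L"
      using 1 adj_A by (auto simp: opcomp_def)
    obtain r where r: "(k, r) \<in> adj Ld" "(r, y2) \<in> Ld" using 2 by (auto simp: opcomp_def)
    have bound: "2 * Re (cinner g d) - (cnorm d)\<^sup>2 \<le> Re (cinner v y1)" if "d \<in> Domain Ld" for d
    proof -
      obtain z where z: "(d, z) \<in> Ld" using \<open>d \<in> Domain Ld\<close> by auto
      have "(V d, z) \<in> C" using V_A[OF z] saC(3) by auto
      then have "0 \<le> Re (cinner (v - V d) (y1 - z))"
        by (rule nonneg_opD[OF saC(2) is_linop_diff[OF selfadjoint_opD(1)[OF saC(1)] 1]])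
      moreover have "Re (cinner (V d) y1) = Re (cinner g d)"
        using selfadjoint_cinner[OF L(1) V_in[of d] g(2)] Re_cinner_commute[of g d] by simp
      moreover have "Re (cinner v z) = Re (cinner g d)"
        using adjD[OF g(1) z] Re_cinner_commute[of v z] Re_cinner_commute[of g d] by simp
      moreover have "Re (cinner (V d) z) = (cnorm d)\<^sup>2"
        by (simp add: A_form[OF z] cnorm_sq)
      ultimately show ?thesis
        by (simp add: cinner_diff_left cinner_diff_right)
    qed
    obtain D where D: "\<And>n. D n \<in> Domain Ld" "ctends D g"
      using cdense_sequence Ld(3) unfolding densely_defined_def by blast
    have "(\<lambda>n. 2 * Re (cinner g (D n)) - (cnorm (D n))\<^sup>2) \<longlonglongrightarrow> 2 * Re (cinner g g) - (cnorm g)\<^sup>2"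
      by (intro tendsto_intros ctends_cinner_right ctends_cnorm D)
    then have "2 * Re (cinner g g) - (cnorm g)\<^sup>2 \<le> Re (cinner v y1)"
      by (rule LIMSEQ_le_const2) (use bound[OF D(1)] in blast)
    then have form: "(cnorm g)\<^sup>2 \<le> Re (cinner v y1)" by (simp flip: cnorm_sq)
    \<comment> \<open>The squares are the form of \<open>Ld (adj Ld) + a\<close> at
      \<open>v - k\<close>. Their mixed terms amount to \<open>Re (cinner h v)\<close>, and by
      \<open>form\<close> the terms in \<open>g\<close> and \<open>v\<close> are at most the same
      quantity, so it remains below \<open>Re (cinner h k)\<close>.\<close>
    have "0 \<le> (cnorm (g - r))\<^sup>2 + a * (cnorm (v - k))\<^sup>2" using a by simp
    moreover have "Re (cinner h k) = (cnorm r)\<^sup>2 + a * (cnorm k)\<^sup>2"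
      using adjD[OF r] by (simp add: h_def cinner_simps cnorm_sq)
    moreover have "Re (cinner h v) = Re (cinner g r) + a * Re (cinner v k)"
      using adjD[OF g(1) r(2)] Re_cinner_commute[of g r] Re_cinner_commute[of k v]
      by (simp add: h_def cinner_simps)
    moreover have "Re (cinner h v) = Re (cinner v y1) + a * (cnorm v)\<^sup>2"
      using Re_cinner_commute[of v y1] by (simp add: h_def cinner_simps cnorm_sq flip: eq)
    ultimately have "Re (cinner h v) \<le> Re (cinner h k)"
      using form by (simp add: cnorm_diff_sq algebra_simps)
    then show "Re (cinner (y1 + cscale (complex_of_real a) v) v)
        \<le> Re (cinner (y2 + cscale (complex_of_real a) k) k)"
      by (simp add: eq flip: h_def)
  qed
  ultimately show ?thesis
    using von_neumann_selfadjoint[OF Ld(1-3)] by (simp add: is_krein_ext_def nonneg_sa_ext_def)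
qed

end

text \<open>\<open>M Ld\<close> is contained in \<open>L L\<close>, so its domain lies in the
  trivial intersection. The factor \<open>M\<close> will be \<open>L\<close> or \<open>Ld\<close>,
  which covers both parts of claim (4).\<close>

lemma Domain_opcomp_trivial:
  assumes "Domain Ld \<inter> Domain (opcomp L L) = {0}" "Ld \<subseteq> L" "M \<subseteq> L" "is_linop M" "is_linop Ld"
  shows "Domain (opcomp M Ld) = {0}"
proof
  show "Domain (opcomp M Ld) \<subseteq> {0}"
    using assms(1-3) by (fastforce simp: opcomp_def)
  show "{0} \<subseteq> Domain (opcomp M Ld)"
    using is_linop_zero[OF is_linop_opcomp[OF assms(4,5)]] by auto
qed

section \<open>Derivation of the nine assertions for the restrictions \<open>Ld1\<close> and
  \<open>Ld2\<close>\<close>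

theorem theorem3p29:
  fixes T T1 T2 L Ld1 Ld2 :: "('a::chilbert_space \<times> 'a) set"
  assumes H: "infinite_dimensional TYPE('a)" "separable_space TYPE('a)"
    and T: "selfadjoint_op T" "nonneg_op T" "unbounded_op T"
    and T1: "selfadjoint_op T1" "nonneg_op T1" "unbounded_op T1"
    and T2: "selfadjoint_op T2" "nonneg_op T2" "unbounded_op T2"
    and dom1: "Domain (op_sqrt T1) \<inter> Domain T = {0}"
    and dom2: "Domain (op_sqrt T2) \<inter> Domain T = {0}"
    and sub1: "Domain (op_sqrt T1) \<subseteq> Domain (op_sqrt T)"
    and sub2: "Domain (op_sqrt T2) \<subseteq> Domain (op_sqrt T)"
    and nrm1: "\<forall>g\<in>Domain (op_sqrt T1). cnorm (app (op_sqrt T1) g) = cnorm (app (op_sqrt T) g)"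
    and nrm2: "\<forall>g\<in>Domain (op_sqrt T2). cnorm (app (op_sqrt T2) g) = cnorm (app (op_sqrt T) g)"
    and int12: "Domain (op_sqrt T1) \<inter> Domain (op_sqrt T2) = {0}"
    and dsum: "direct_sum_eq (Domain (op_sqrt T)) (Domain (op_sqrt T1)) (Domain (op_sqrt T2))"
    and orth: "\<forall>f\<in>Domain (op_sqrt T1). \<forall>g\<in>Domain (op_sqrt T2).
                 cinner (app (op_sqrt T) f) (app (op_sqrt T) g) + cinner f g = 0"
    and L_def: "L = op_sqrt T"
    and Ld1_def: "Ld1 = op_restrict L (Domain (op_sqrt T1))"
    and Ld2_def: "Ld2 = op_restrict L (Domain (op_sqrt T2))"
  shows
    "(closed_op Ld1 \<and> densely_defined Ld1 \<and> symmetric_op Ld1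
     \<and> closed_op Ld2 \<and> densely_defined Ld2 \<and> symmetric_op Ld2)
     \<and> (Domain Ld1 \<inter> Domain (opcomp L L) = {0} \<and> Domain Ld2 \<inter> Domain (opcomp L L) = {0})
     \<and> (Domain Ld1 \<inter> Domain Ld2 = {0} \<and> direct_sum_eq (Domain L) (Domain Ld1) (Domain Ld2))
     \<and> (Domain (opcomp L Ld1) = {0} \<and> Domain (opcomp L Ld2) = {0}
         \<and> Domain (opcomp Ld1 Ld1) = {0} \<and> Domain (opcomp Ld2 Ld2) = {0})
     \<and> (Range T = UNIV \<longrightarrow>
           (\<forall>Ld\<in>{Ld1, Ld2}.
              densely_defined (opcomp Ld L) \<and> symmetric_op (opcomp Ld L) \<and> nonneg_op (opcomp Ld L)
            \<and> adj (opcomp Ld L) = opcomp L (adj Ld)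
            \<and> opcomp L L = T \<and> is_friedrichs_ext (opcomp Ld L) (opcomp L L)
            \<and> is_krein_ext (opcomp Ld L) (opcomp Ld (adj Ld)))
         \<and> Domain (opcomp Ld1 L) \<inter> Domain (opcomp Ld2 L) = {0}
         \<and> direct_sum_eq (Domain (opcomp L L)) (Domain (opcomp Ld1 L)) (Domain (opcomp Ld2 L)))"
proof -
  have L: "selfadjoint_op L" "nonneg_op L" "opcomp L L = T"
    using op_sqrt[OF T(1,2)] by (simp_all add: L_def)
  note linL = selfadjoint_opD(1)[OF L(1)]
  note R1 = op_restrict_isometric[OF L(1) op_sqrt(1)[OF T1(1,2)] sub1[folded L_def] nrm1[folded L_def],
      folded Ld1_def]
  note R2 = op_restrict_isometric[OF L(1) op_sqrt(1)[OF T2(1,2)] sub2[folded L_def] nrm2[folded L_def],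
      folded Ld2_def]
  have D: "Domain Ld1 = Domain (op_sqrt T1)" "Domain Ld2 = Domain (op_sqrt T2)"
    using sub1 sub2 by (auto simp: Ld1_def Ld2_def L_def op_restrict_def)
  have sub: "Ld1 \<subseteq> L" "Ld2 \<subseteq> L" by (auto simp: Ld1_def Ld2_def op_restrict_def)
  have int: "Domain Ld1 \<inter> Domain (opcomp L L) = {0}" "Domain Ld2 \<inter> Domain (opcomp L L) = {0}"
    using dom1 dom2 by (simp_all add: L(3) D)
  have sum: "direct_sum_eq (Domain L) (Domain Ld1) (Domain Ld2)"
    using dsum by (simp add: D L_def)
  have int12': "Domain Ld1 \<inter> Domain Ld2 = {0}" using int12 by (simp add: D)
  note triv1 = Domain_opcomp_trivial[OF int(1) sub(1) _ _ R1(1)]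
    and triv2 = Domain_opcomp_trivial[OF int(2) sub(2) _ _ R2(1)]
  note triv = triv1[OF order_refl linL] triv2[OF order_refl linL]
    triv1[OF sub(1) R1(1)] triv2[OF sub(2) R2(1)]
  have surjective_case: "(\<forall>Ld\<in>{Ld1, Ld2}.
              densely_defined (opcomp Ld L) \<and> symmetric_op (opcomp Ld L) \<and> nonneg_op (opcomp Ld L)
            \<and> adj (opcomp Ld L) = opcomp L (adj Ld)
            \<and> opcomp L L = T \<and> is_friedrichs_ext (opcomp Ld L) (opcomp L L)
            \<and> is_krein_ext (opcomp Ld L) (opcomp Ld (adj Ld)))
         \<and> Domain (opcomp Ld1 L) \<inter> Domain (opcomp Ld2 L) = {0}
         \<and> direct_sum_eq (Domain (opcomp L L)) (Domain (opcomp Ld1 L)) (Domain (opcomp Ld2 L))"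
    if ran: "Range T = UNIV"
  proof -
    have "Range L = UNIV" using ran unfolding L(3)[symmetric] opcomp_def by fast
    then interpret c1: closed_restriction L Ld1 + c2: closed_restriction L Ld2
      by unfold_locales (use L R1 R2 sub in simp_all)
    \<comment> \<open>The case \<open>Ld = L\<close> yields \<open>Domain (opcomp L L) = V\<close>
      applied to \<open>Domain L\<close>. Since \<open>V\<close> depends on \<open>L\<close> only,
      the three interpretations share it.\<close>
    interpret c: closed_restriction L L
      by unfold_locales (use \<open>Range L = UNIV\<close> L selfadjoint_opD[OF L(1)] in simp_all)
    have sum': "Domain Ld1 \<inter> Domain Ld2 = {0}" "Domain L = {x + y |x y. x \<in> Domain Ld1 \<and> y \<in> Domain Ld2}"
      using sum by (simp_all add: direct_sum_eq_def)
    \<comment> \<open>\<open>V\<close> is additive and injective, so it carries the direct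
      decomposition of \<open>Domain L\<close> to that of
      \<open>Domain (opcomp L L)\<close>.\<close>
    have "inj c.V"
      by (rule injI) (metis c.V_in is_linop_unique[OF linL])
    then have I: "Domain (opcomp Ld1 L) \<inter> Domain (opcomp Ld2 L) = {0}"
      by (simp add: c1.Domain_A c2.Domain_A sum'(1) c.V_eq[OF is_linop_zero[OF linL]] flip: image_Int)
    moreover have "Domain (opcomp L L) = {x + y |x y. x \<in> Domain (opcomp Ld1 L) \<and> y \<in> Domain (opcomp Ld2 L)}"
    proof -
      have "c.V ` {x + y |x y. x \<in> P \<and> y \<in> Q} = {x + y |x y. x \<in> c.V ` P \<and> y \<in> c.V ` Q}" for P Q
      proof (intro equalityI subsetI)
        fix w assume "w \<in> {x + y |x y. x \<in> c.V ` P \<and> y \<in> c.V ` Q}"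
        then obtain x y where xy: "x \<in> P" "y \<in> Q" "w = c.V (x + y)" by (auto simp: c.V_add)
        then show "w \<in> c.V ` {x + y |x y. x \<in> P \<and> y \<in> Q}" by blast
      qed (use c.V_add in blast)
      then show ?thesis by (simp only: c.Domain_A c1.Domain_A c2.Domain_A sum'(2))
    qed
    ultimately show ?thesis
      using c1.A_densely_defined c1.A_symmetric c1.A_nonneg c1.adj_A c1.friedrichs c1.krein
        c2.A_densely_defined c2.A_symmetric c2.A_nonneg c2.adj_A c2.friedrichs c2.krein L(3)
      by (simp add: direct_sum_eq_def)
  qed
  show ?thesis
    by (intro conjI impI[OF surjective_case] R1 R2 int int12' sum triv)
qed

end
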